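(* Let $(R,\mathfrak m)$ be a Noetherian local ring of dimension $d\ge1$ and let $\boldsymbol{\mathcal I}=(\mathcal I^{(1)},\ldots,\mathcal I^{(s)})$, $\mathcal I^{(i)}=\{I^{(i)}_n\}_{n\ge0}$, be graded $\mathfrak m$-primary families. Assume that $R/\mathfrak m$ is infinite and that $\boldsymbol{\mathcal I}$ is multigraded admissible with respect to $\mathbf J=(J_1,\ldots,J_s)$. If $\mathbf r=(r_1,\ldots,r_s)\in\mathbb N^s$ satisfies $r_1+\cdots+r_s=d$, then there exist $x_{ij}\in J_i\subseteq I_1^{(i)}$ ($1\le i\le s$, $1\le j\le r_i$) such that $$\mathcal F(\mathbf n)=\sum_{i=1}^{s}\sum_{j=1}^{r_i}x_{ij}\,\mathcal F(\mathbf n-\mathbf e_i)\qquad\text{for }\mathbf n\gg\mathbf0,$$ where $\mathcal F(\mathbf n)=I^{(1)}_{n_1}\cdots I^{(s)}_{n_s}$. In particular, $\{x_{ij}\}$ is a degree-one strong homogeneous joint reduction of type $\mathbf r$.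
   Context: $\mathbb N$ includes $0$; $\mathbf e_i$ is the $i$-th unit vector; "$\mathbf n\gg\mathbf 0$" means: for all $\mathbf n\geq\mathbf n_0$ componentwise, for some $\mathbf n_0\in\mathbb N^s$. A graded $\mathfrak m$-primary family is a family $\mathcal I=\{I_n\}_{n\ge0}$ of ideals with $I_0=R$, $I_n$ $\mathfrak m$-primary for $n>0$, and $I_mI_n\subseteq I_{m+n}$. Multigraded admissibility: put $\mathcal F(\mathbf n)=I^{(1)}_{n_1}\cdots I^{(s)}_{n_s}$ for $\mathbf n\in\mathbb N^s$ and extend to $\mathbf n\in\mathbb Z^s$ by $\mathcal F(\mathbf n)=\mathcal F(\mathbf n^+)$, $\mathbf n^+=(\max\{n_1,0\},\ldots,\max\{n_s,0\})$. The collection is multigraded admissible with respect to a tuple $\mathbf J=(J_1,\ldots,J_s)$ of $\mathfrak m$-primary ideals if for all $\mathbf m,\mathbf n\in\mathbb Z^s$: (1) $J_1^{n_1}\cdots J_s^{n_s}\subseteq\mathcal F(\mathbf n)$ (with $J_i^{n_i}=R$ if $n_i\le0$); (2) $\mathcal F(\mathbf n)\mathcal F(\mathbf m)\subseteq\mathcal F(\mathbf n+\mathbf m)$; (3) $\mathbf m\ge\mathbf n$ implies $\mathcal F(\mathbf m)\subseteq\mathcal F(\mathbf n)$; (4) $\bigoplus_{\mathbf n\in\mathbb Z^s}\mathcal F(\mathbf n)\mathbf t^{\mathbf n}$ is a finite module over $R[J_1t_1,\ldots,J_st_s,t_1^{-1},\ldots,t_s^{-1}]$. Strong homogeneous joint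 reduction of type $\mathbf r$: positive integers $a_{ij}$ and elements $x_{ij}\in I^{(i)}_{a_{ij}}$ ($1\le i\le s$, $1\le j\le r_i$) with $\mathcal F(\mathbf n)=\sum_{i,j}x_{ij}\mathcal F(\mathbf n-a_{ij}\mathbf e_i)$ for all $\mathbf n\gg\mathbf 0$. It is of degree one if all $a_{ij}=1$. *)

theory Defs
  imports
    "HOL-Algebra.Algebra"
    "HOL-Library.Extended_Nat"
    "HOL-Library.Function_Algebras"
begin

section \<open>Noetherian local rings, dimension, primary ideals\<close>

text \<open>The library's \<^locale>\<open>noetherian_ring\<close> does not include commutativity.\<close>

locale noetherian_local_ring = cring R + noetherian_ring R for R (structure) +
  fixes M :: "'a set"
  assumes maximal: "maximalideal M R"
    and maximal_unique: "maximalideal N R \<Longrightarrow> N = M"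

definition krull_dim :: "('a, 'b) ring_scheme \<Rightarrow> enat" where
  "krull_dim R = Sup {enat n | n. \<exists>P :: nat \<Rightarrow> 'a set.
     (\<forall>i\<le>n. primeideal (P i) R) \<and> (\<forall>i<n. P i \<subset> P (Suc i))}"

definition radical :: "('a, 'b) ring_scheme \<Rightarrow> 'a set \<Rightarrow> 'a set" where
  "radical R Q = {a \<in> carrier R. \<exists>n::nat. a [^]\<^bsub>R\<^esub> n \<in> Q}"

definition primary_ideal :: "('a, 'b) ring_scheme \<Rightarrow> 'a set \<Rightarrow> bool" where
  "primary_ideal R Q \<longleftrightarrow> ideal Q R \<and> Q \<noteq> carrier R \<and>
     (\<forall>a\<in>carrier R. \<forall>b\<in>carrier R. a \<otimes>\<^bsub>R\<^esub> b \<in> Q \<longrightarrow> a \<in> Q \<or> b \<in> radical R Q)"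

definition m_primary :: "('a, 'b) ring_scheme \<Rightarrow> 'a set \<Rightarrow> 'a set \<Rightarrow> bool" where
  "m_primary R M Q \<longleftrightarrow> primary_ideal R Q \<and> radical R Q = M"


section \<open>Graded families and the multigraded filtration\<close>

text \<open>
  The index set \<open>{1, \<dots>, s}\<close> is rendered as a finite type \<open>'s\<close>, so that multidegrees in
  \<open>\<int>\<^sup>s\<close> are functions \<open>'s \<Rightarrow> int\<close> with the pointwise order and addition.  Products, powers and
  sums of ideals are those of the semiring of ideals \<^const>\<open>ideals_set\<close>.
\<close>

definition graded_m_primary_family ::
  "('a, 'b) ring_scheme \<Rightarrow> 'a set \<Rightarrow> (nat \<Rightarrow> 'a set) \<Rightarrow> bool" where
  "graded_m_primary_family R M I \<longleftrightarrow>
     (\<forall>n. ideal (I n) R) \<and> I 0 = carrier R \<and> (\<forall>n>0. m_primary R M (I n)) \<and>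
     (\<forall>m n. ideal_prod R (I m) (I n) \<subseteq> I (m + n))"

text \<open>
  Since \<^term>\<open>nat k = 0\<close> for \<open>k \<le> 0\<close>, the following two definitions include the extension from
  \<open>\<nat>\<^sup>s\<close> to \<open>\<int>\<^sup>s\<close>, by \<open>F(n) = F(n\<^sup>+)\<close> and by \<open>J\<^sub>i\<^sup>k = R\<close> for \<open>k \<le> 0\<close> respectively.
\<close>

definition mfilt ::
  "('a, 'b) ring_scheme \<Rightarrow> ('s::finite \<Rightarrow> nat \<Rightarrow> 'a set) \<Rightarrow> ('s \<Rightarrow> int) \<Rightarrow> 'a set" where
  "mfilt R I n = (\<Otimes>\<^bsub>ideals_set R\<^esub> i \<in> UNIV. I i (nat (n i)))"

definition mpow ::
  "('a, 'b) ring_scheme \<Rightarrow> ('s::finite \<Rightarrow> 'a set) \<Rightarrow> ('s \<Rightarrow> int) \<Rightarrow> 'a set" where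
  "mpow R J n = (\<Otimes>\<^bsub>ideals_set R\<^esub> i \<in> UNIV. J i [^]\<^bsub>ideals_set R\<^esub> nat (n i))"

text \<open>The vector \<open>c e\<^sub>i\<close>.\<close>

definition evec :: "'s \<Rightarrow> int \<Rightarrow> 's \<Rightarrow> int" where
  "evec i c = (\<lambda>k. if k = i then c else 0)"


section \<open>Laurent polynomials and the extended Rees algebra\<close>

text \<open>
  \<open>R[t\<^sub>1, t\<^sub>1\<^sup>-\<^sup>1, \<dots>, t\<^sub>s, t\<^sub>s\<^sup>-\<^sup>1]\<close>; an element is its finitely supported coefficient function.
\<close>

definition laurent_ring :: "('a, 'b) ring_scheme \<Rightarrow> (('s::finite \<Rightarrow> int) \<Rightarrow> 'a) ring" where
  "laurent_ring R =
     \<lparr> carrier = {f. (\<forall>n. f n \<in> carrier R) \<and> finite {n. f n \<noteq> \<zero>\<^bsub>R\<^esub>}},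
       monoid.mult = (\<lambda>f g n. \<Oplus>\<^bsub>R\<^esub> k \<in> {k. f k \<noteq> \<zero>\<^bsub>R\<^esub>}. f k \<otimes>\<^bsub>R\<^esub> g (n - k)),
       one = (\<lambda>n. if n = 0 then \<one>\<^bsub>R\<^esub> else \<zero>\<^bsub>R\<^esub>),
       ring.zero = (\<lambda>n. \<zero>\<^bsub>R\<^esub>),
       ring.add = (\<lambda>f g n. f n \<oplus>\<^bsub>R\<^esub> g n) \<rparr>"

text \<open>The monomial \<open>a t\<^sup>n\<close>.\<close>

definition lmonom ::
  "('a, 'b) ring_scheme \<Rightarrow> 'a \<Rightarrow> ('s::finite \<Rightarrow> int) \<Rightarrow> ('s \<Rightarrow> int) \<Rightarrow> 'a" where
  "lmonom R a n = (\<lambda>k. if k = n then a else \<zero>\<^bsub>R\<^esub>)"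

text \<open>\<open>R[J\<^sub>1t\<^sub>1, \<dots>, J\<^sub>st\<^sub>s, t\<^sub>1\<^sup>-\<^sup>1, \<dots>, t\<^sub>s\<^sup>-\<^sup>1]\<close> as a subring of the Laurent polynomial ring.\<close>

definition ext_rees ::
  "('a, 'b) ring_scheme \<Rightarrow> ('s::finite \<Rightarrow> 'a set) \<Rightarrow> (('s \<Rightarrow> int) \<Rightarrow> 'a) set" where
  "ext_rees R J = generate_ring (laurent_ring R)
     ({lmonom R a 0 | a. a \<in> carrier R} \<union>
      {lmonom R a (evec i 1) | a i. a \<in> J i} \<union>
      {lmonom R \<one>\<^bsub>R\<^esub> (evec i (-1)) | i. True})"

text \<open>\<open>\<Oplus>\<^sub>n F(n) t\<^sup>n\<close>.\<close>

definition rees_sum ::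
  "('a, 'b) ring_scheme \<Rightarrow> (('s::finite \<Rightarrow> int) \<Rightarrow> 'a set) \<Rightarrow> (('s \<Rightarrow> int) \<Rightarrow> 'a) set" where
  "rees_sum R F = {f \<in> carrier (laurent_ring R). \<forall>n. f n \<in> F n}"

text \<open>
  For a subring \<open>A\<close> of \<open>S\<close>, the subset \<open>N\<close> of \<open>S\<close> is a finitely generated \<open>A\<close>-submodule.
\<close>

definition finite_module_over :: "('c, 'b) ring_scheme \<Rightarrow> 'c set \<Rightarrow> 'c set \<Rightarrow> bool" where
  "finite_module_over S A N \<longleftrightarrow>
     (\<exists>G. finite G \<and> G \<subseteq> N \<and>
       N = {\<Oplus>\<^bsub>S\<^esub> g \<in> G. c g \<otimes>\<^bsub>S\<^esub> g | c. c \<in> G \<rightarrow> A})"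


section \<open>Multigraded admissibility and strong joint reductions\<close>

definition multigraded_admissible ::
  "('a, 'b) ring_scheme \<Rightarrow> 'a set \<Rightarrow> ('s::finite \<Rightarrow> nat \<Rightarrow> 'a set) \<Rightarrow> ('s \<Rightarrow> 'a set) \<Rightarrow> bool" where
  "multigraded_admissible R M I J \<longleftrightarrow>
     (\<forall>i. m_primary R M (J i)) \<and>
     (\<forall>n. mpow R J n \<subseteq> mfilt R I n) \<and>
     (\<forall>m n. ideal_prod R (mfilt R I n) (mfilt R I m) \<subseteq> mfilt R I (n + m)) \<and>
     (\<forall>m n. n \<le> m \<longrightarrow> mfilt R I m \<subseteq> mfilt R I n) \<and>
     finite_module_over (laurent_ring R) (ext_rees R J) (rees_sum R (mfilt R I))"

text \<open>\<open>P\<close> holds for all \<open>n \<ggreater> 0\<close>.\<close>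

definition for_large :: "(('s::finite \<Rightarrow> int) \<Rightarrow> bool) \<Rightarrow> bool" where
  "for_large P \<longleftrightarrow> (\<exists>n0 :: 's \<Rightarrow> nat. \<forall>n. (\<forall>i. int (n0 i) \<le> n i) \<longrightarrow> P n)"

definition strong_homogeneous_joint_reduction ::
  "('a, 'b) ring_scheme \<Rightarrow> ('s::finite \<Rightarrow> nat \<Rightarrow> 'a set) \<Rightarrow> ('s \<Rightarrow> nat) \<Rightarrow>
   ('s \<Rightarrow> nat \<Rightarrow> nat) \<Rightarrow> ('s \<Rightarrow> nat \<Rightarrow> 'a) \<Rightarrow> bool" where
  "strong_homogeneous_joint_reduction R I r a x \<longleftrightarrow>
     (\<forall>i. \<forall>j\<in>{1..r i}. 0 < a i j \<and> x i j \<in> I i (a i j)) \<and>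
     for_large (\<lambda>n. mfilt R I n =
       (\<Oplus>\<^bsub>ideals_set R\<^esub> i \<in> UNIV. \<Oplus>\<^bsub>ideals_set R\<^esub> j \<in> {1..r i}.
          x i j <#\<^bsub>R\<^esub> mfilt R I (n - evec i (int (a i j)))))"

definition degree_one_strong_homogeneous_joint_reduction ::
  "('a, 'b) ring_scheme \<Rightarrow> ('s::finite \<Rightarrow> nat \<Rightarrow> 'a set) \<Rightarrow> ('s \<Rightarrow> nat) \<Rightarrow>
   ('s \<Rightarrow> nat \<Rightarrow> 'a) \<Rightarrow> bool" where
  "degree_one_strong_homogeneous_joint_reduction R I r x \<longleftrightarrow>
     strong_homogeneous_joint_reduction R I r (\<lambda>i j. 1) x"

end

theory Submission
  imports Defs
begin

text \<open>
  Write \<open>J(n)\<close> for the product of the powers \<open>J\<^sub>i\<close> to the \<open>n\<^sub>i\<close>.  Admissibility makes every \<open>F(n)\<close> with \<open>n \<ggreater> 0\<close>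
  a finite sum of terms \<open>J(n - m) g\<^sub>m\<close>, with \<open>m\<close> ranging over a fixed finite set, so it is enough to find
  elements with \<open>J(n) = \<Sum> x\<^sub>i\<^sub>j J(n - e\<^sub>i)\<close> for \<open>n \<ggreater> 0\<close>.  Put \<open>K = J\<^sub>1 \<cdots> J\<^sub>s\<close> and work in the Rees algebra
  modulo \<open>K\<close>.  Choose the \<open>x\<^sub>i\<^sub>j\<close> one after the other, each outside the finitely many minimal relevant
  primes over the previous ones; this is possible because the residue field is infinite.  If a relevant
  prime contained all \<open>d\<close> of them, it would lie on top of a chain of relevant primes \<open>P\<^sub>0 \<subset> \<dots> \<subset> P\<^sub>d\<close> in
  which each step is witnessed by one \<open>x\<^sub>i\<^sub>j\<close>, and multiplication by the \<open>x\<^sub>i\<^sub>j\<close> would force the length of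
  \<open>J(n)/P\<^sub>0(n)\<close> to be at least \<open>m\<^sup>d\<close> for \<open>n \<ge> (dm, \<dots>, dm)\<close>.  Summing along the diagonal, \<open>R/K\<^sup>N\<close> would have
  length at least of order \<open>N\<^sup>d\<^sup>+\<^sup>1\<close>, whereas a system of parameters bounds this length by a multiple of
  \<open>N\<^sup>d\<close>.  Hence the quotient by the \<open>x\<^sub>i\<^sub>j\<close> vanishes in large degrees, and Nakayama's lemma removes \<open>K\<close>.
\<close>

no_notation Sum_Type.Plus (infixr \<open><+>\<close> 65)

section \<open>Chains of ideals\<close>

text \<open>Expresses "\<open>J/I\<close> has length at least \<open>l\<close>" inside
  \<open>R\<close>: strict steps start at \<open>I\<close>, and the last ideal reached only has to
  lie inside \<open>J\<close>. The weak inclusion at the end makes the notion monotone in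
  \<open>J\<close> and antitone in \<open>I\<close>, so chains can be transported freely.\<close>

primrec ideal_chain :: "('a, 'b) ring_scheme \<Rightarrow> 'a set \<Rightarrow> 'a set \<Rightarrow> nat \<Rightarrow> bool" where
  "ideal_chain R J I 0 \<longleftrightarrow> I \<subseteq> J"
| "ideal_chain R J I (Suc l) \<longleftrightarrow> (\<exists>L. ideal L R \<and> I \<subset> L \<and> ideal_chain R J L l)"

definition length_le :: "('a, 'b) ring_scheme \<Rightarrow> 'a set \<Rightarrow> 'a set \<Rightarrow> nat \<Rightarrow> bool" where
  "length_le R J I c \<longleftrightarrow> (\<forall>l. ideal_chain R J I l \<longrightarrow> l \<le> c)"

lemma ideal_chain_subset: "ideal_chain R J I l \<Longrightarrow> I \<subseteq> J"
  by (induction l arbitrary: I) auto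

lemma ideal_chain_antimono: "ideal_chain R J I l \<Longrightarrow> I' \<subseteq> I \<Longrightarrow> ideal_chain R J I' l"
  by (cases l) (simp_all, blast)

lemma ideal_chain_mono: "ideal_chain R J I l \<Longrightarrow> J \<subseteq> J' \<Longrightarrow> ideal_chain R J' I l"
  by (induction l arbitrary: I) auto

lemma ideal_chain_concat:
  "ideal_chain R L I a \<Longrightarrow> ideal_chain R J L b \<Longrightarrow> ideal_chain R J I (a + b)"
  by (induction a arbitrary: I) (auto intro: ideal_chain_antimono)

lemma length_le_antimono: "length_le R J I c \<Longrightarrow> I \<subseteq> I' \<Longrightarrow> length_le R J I' c"
  unfolding length_le_def using ideal_chain_antimono by blast

lemma length_le_mono: "length_le R J I c \<Longrightarrow> c \<le> c' \<Longrightarrow> length_le R J I c'"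
  unfolding length_le_def using le_trans by blast

context cring
begin

section \<open>Elementary arithmetic of sums, multiples and colons of ideals\<close>

lemma idealI':
  assumes "I \<subseteq> carrier R" and "\<zero> \<in> I"
    and "\<And>a b. a \<in> I \<Longrightarrow> b \<in> I \<Longrightarrow> a \<oplus> b \<in> I"
    and m: "\<And>a r. a \<in> I \<Longrightarrow> r \<in> carrier R \<Longrightarrow> r \<otimes> a \<in> I"
  shows "ideal I R"
proof (rule idealI[OF ring_axioms])
  show "subgroup I (add_monoid R)"
  proof (rule group.subgroupI[OF a_group], simp_all add: assms)
    fix a assume a: "a \<in> I"
    then have "(\<ominus> \<one>) \<otimes> a \<in> I" by (intro m) auto
    then show "inv\<^bsub>add_monoid R\<^esub> a \<in> I"
      using a assms(1) by (metis a_inv_def l_minus l_one one_closed subsetD)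
  qed (use assms in auto)
  show "x \<otimes> a \<in> I" if "a \<in> I" "x \<in> carrier R" for a x using m that by blast
  then show "a \<otimes> x \<in> I" if "a \<in> I" "x \<in> carrier R" for a x
    using that assms(1) m_comm by (metis subsetD)
qed

lemma ideal_add: "ideal I R \<Longrightarrow> a \<in> I \<Longrightarrow> b \<in> I \<Longrightarrow> a \<oplus> b \<in> I"
  by (simp add: additive_subgroup.a_closed ideal.axioms(1))

lemma ideal_zero: "ideal I R \<Longrightarrow> \<zero> \<in> I"
  by (simp add: additive_subgroup.zero_closed ideal.axioms(1))

lemma ideal_subset: "ideal I R \<Longrightarrow> I \<subseteq> carrier R"
  by (simp add: additive_subgroup.a_subset ideal.axioms(1))

lemma ideal_minus: "ideal I R \<Longrightarrow> a \<in> I \<Longrightarrow> b \<in> I \<Longrightarrow> a \<ominus> b \<in> I"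
  by (simp add: a_minus_def ideal_add additive_subgroup.a_inv_closed ideal.axioms(1))

lemma ideal_minus_cancel:
  assumes "ideal I R" "b \<in> I" "a \<in> carrier R" "a \<ominus> b \<in> I"
  shows "a \<in> I"
proof -
  have "a = (a \<ominus> b) \<oplus> b"
    using assms ideal.Icarr[OF assms(1,2)] by (simp add: a_minus_def a_assoc l_neg)
  then show ?thesis using ideal_add assms by metis
qed

lemma ideal_add_cancel:
  assumes "ideal I R" "a \<in> I" "b \<in> carrier R" "a \<oplus> b \<in> I"
  shows "b \<in> I"
proof -
  have "b = (a \<oplus> b) \<ominus> a"
    using assms ideal.Icarr[OF assms(1,2)] by (metis a_minus_def a_comm a_assoc r_neg r_zero a_inv_closed)
  then show ?thesis using ideal_minus assms by metis
qed

lemma ideal_sum_left: "ideal I R \<Longrightarrow> ideal J R \<Longrightarrow> I \<subseteq> I <+> J"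
  by (metis Un_subset_iff genideal_self ideal_subset union_genideal)

lemma ideal_sum_right: "ideal I R \<Longrightarrow> ideal J R \<Longrightarrow> J \<subseteq> I <+> J"
  by (metis Un_subset_iff genideal_self ideal_subset union_genideal)

lemma ideal_sum_least: "ideal L R \<Longrightarrow> I \<subseteq> L \<Longrightarrow> J \<subseteq> L \<Longrightarrow> I <+> J \<subseteq> L"
  using ideal_add by (fastforce simp: set_add_def')

lemma set_add_mono: "I \<subseteq> I' \<Longrightarrow> J \<subseteq> J' \<Longrightarrow> I <+> J \<subseteq> I' <+> J'"
  unfolding set_add_def' by blast

lemma l_coset_mono: "J \<subseteq> J' \<Longrightarrow> x <# J \<subseteq> x <# J'"
  unfolding l_coset_def by blast

lemma ideal_l_coset:
  assumes "ideal J R" "x \<in> carrier R"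
  shows "ideal (x <# J) R"
proof (rule idealI')
  show "x <# J \<subseteq> carrier R"
    using assms ideal_subset by (fastforce simp: l_coset_def)
  show "\<zero> \<in> x <# J"
    using assms ideal_zero by (force simp: l_coset_def)
  show "a \<oplus> b \<in> x <# J" if ab: "a \<in> x <# J" "b \<in> x <# J" for a b
  proof -
    from ab obtain u v where uv: "u \<in> J" "v \<in> J" "a = x \<otimes> u" "b = x \<otimes> v"
      by (auto simp: l_coset_def)
    then have "a \<oplus> b = x \<otimes> (u \<oplus> v)"
      using assms ideal.Icarr by (metis r_distr)
    then show ?thesis using ideal_add[OF assms(1) uv(1,2)] by (auto simp: l_coset_def)
  qed
  show "r \<otimes> a \<in> x <# J" if a: "a \<in> x <# J" and r: "r \<in> carrier R" for a r
  proof -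
    from a obtain u where u: "u \<in> J" "a = x \<otimes> u"
      by (auto simp: l_coset_def)
    then have "r \<otimes> a = x \<otimes> (r \<otimes> u)"
      using assms ideal.Icarr r by (metis m_lcomm)
    then show ?thesis using ideal.I_l_closed[OF assms(1) u(1) r] by (auto simp: l_coset_def)
  qed
qed

lemma ideal_colon:
  assumes "ideal A R" "y \<in> carrier R"
  shows "ideal {r \<in> carrier R. r \<otimes> y \<in> A} R"
proof (rule idealI')
  show "\<zero> \<in> {r \<in> carrier R. r \<otimes> y \<in> A}" using assms ideal_zero by auto
  show "a \<oplus> b \<in> {r \<in> carrier R. r \<otimes> y \<in> A}"
    if "a \<in> {r \<in> carrier R. r \<otimes> y \<in> A}" "b \<in> {r \<in> carrier R. r \<otimes> y \<in> A}" for a b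
    using that assms ideal_add by (auto simp: l_distr)
  show "r \<otimes> a \<in> {r \<in> carrier R. r \<otimes> y \<in> A}"
    if "a \<in> {r \<in> carrier R. r \<otimes> y \<in> A}" "r \<in> carrier R" for a r
    using that assms ideal.I_l_closed by (fastforce simp: m_assoc)
qed auto

lemma mem_add_cgenideal_iff:
  "z \<in> I <+> PIdl y \<longleftrightarrow> (\<exists>i\<in>I. \<exists>r\<in>carrier R. z = i \<oplus> r \<otimes> y)"
  by (auto simp: set_add_def' cgenideal_def)

lemma add_cgenideal_ideal: "ideal I R \<Longrightarrow> y \<in> carrier R \<Longrightarrow> ideal (I <+> PIdl y) R"
  by (simp add: add_ideals cgenideal_ideal)

lemma add_cgenideal_self: "ideal I R \<Longrightarrow> y \<in> carrier R \<Longrightarrow> y \<in> I <+> PIdl y"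
  using ideal_sum_right cgenideal_ideal cgenideal_self by blast

lemma add_cgenideal_subset: "ideal I R \<Longrightarrow> y \<in> carrier R \<Longrightarrow> I \<subseteq> I <+> PIdl y"
  using ideal_sum_left cgenideal_ideal by blast

lemma add_cgenideal_psubset: "ideal I R \<Longrightarrow> y \<in> carrier R \<Longrightarrow> y \<notin> I \<Longrightarrow> I \<subset> I <+> PIdl y"
  using add_cgenideal_subset add_cgenideal_self by blast

lemma add_cgenideal_least:
  "ideal L R \<Longrightarrow> I \<subseteq> L \<Longrightarrow> y \<in> L \<Longrightarrow> I <+> PIdl y \<subseteq> L"
  by (simp add: cgenideal_minimal ideal_sum_least)

text \<open>Modular law: write an element of \<open>I'\<close> as \<open>i \<oplus> l\<close> with
  \<open>i\<close> in \<open>I\<close> and \<open>l\<close> in \<open>L\<close>. Then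
  \<open>l\<close> lies in \<open>I' \<inter> L = I \<inter> L\<close>, hence in
  \<open>I\<close>.\<close>

lemma ideals_modular_eq:
  assumes "ideal I R" "ideal I' R" "ideal L R" "I \<subseteq> I'"
    and "I \<inter> L = I' \<inter> L" "I <+> L = I' <+> L"
  shows "I = I'"
proof
  show "I' \<subseteq> I"
  proof
    fix z assume z: "z \<in> I'"
    then have "z \<in> I <+> L" using assms ideal_sum_left by blast
    then obtain i l where il: "i \<in> I" "l \<in> L" "z = i \<oplus> l"
      by (auto simp: set_add_def')
    then have "l \<in> I'"
      using z assms ideal_add_cancel[of I' i l] ideal.Icarr[OF assms(3)] by auto
    then have "l \<in> I" using il assms by blast
    then show "z \<in> I" using il assms ideal_add by auto
  qed
qed (use assms in auto)

text \<open>By the modular law, a strict step of the chain stays strict after intersecting with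
  \<open>L\<close> or after adding \<open>L\<close>. Sorting the steps accordingly yields the two
  chains; this is the hard half of the additivity of length.\<close>

lemma ideal_chain_split:
  assumes "ideal I R" "ideal L R" "ideal_chain R J I l"
  shows "\<exists>a b. l \<le> a + b \<and> ideal_chain R (J \<inter> L) (I \<inter> L) a \<and> ideal_chain R (J <+> L) (I <+> L) b"
  using assms
proof (induction l arbitrary: I)
  case 0
  then have "I \<inter> L \<subseteq> J \<inter> L" "I <+> L \<subseteq> J <+> L"
    by (simp_all add: le_infI1 set_add_mono)
  then show ?case using 0 by (intro exI[of _ 0]) auto
next
  case (Suc l)
  then obtain I1 where I1: "ideal I1 R" "I \<subset> I1" "ideal_chain R J I1 l" by auto
  obtain a b where ab: "l \<le> a + b" "ideal_chain R (J \<inter> L) (I1 \<inter> L) a"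
    "ideal_chain R (J <+> L) (I1 <+> L) b"
    using Suc.IH[OF I1(1) Suc.prems(2) I1(3)] by blast
  have sub: "I \<inter> L \<subseteq> I1 \<inter> L" "I <+> L \<subseteq> I1 <+> L"
    using I1(2) by (simp_all add: le_infI1 set_add_mono psubset_imp_subset)
  note weak = ideal_chain_antimono[OF ab(2) sub(1)] ideal_chain_antimono[OF ab(3) sub(2)]
  have "I \<inter> L \<subset> I1 \<inter> L \<or> I <+> L \<subset> I1 <+> L"
    using ideals_modular_eq[OF Suc.prems(1) I1(1) Suc.prems(2)] I1(2) sub by blast
  then show ?case
  proof
    assume "I \<inter> L \<subset> I1 \<inter> L"
    then have "ideal_chain R (J \<inter> L) (I \<inter> L) (Suc a)"
      using ab(2) i_intersect[OF I1(1) Suc.prems(2)] unfolding ideal_chain.simps by blast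
    with weak ab(1) show ?thesis by (intro exI[of _ "Suc a"] exI[of _ b]) simp
  next
    assume "I <+> L \<subset> I1 <+> L"
    then have "ideal_chain R (J <+> L) (I <+> L) (Suc b)"
      using ab(3) add_ideals[OF I1(1) Suc.prems(2)] unfolding ideal_chain.simps by blast
    with weak ab(1) show ?thesis by (intro exI[of _ a] exI[of _ "Suc b"]) simp
  qed
qed

lemma length_le_add:
  assumes "ideal I R" "ideal L R" "ideal J R" "I \<subseteq> L" "L \<subseteq> J"
    and "length_le R L I a" "length_le R J L b"
  shows "length_le R J I (a + b)"
  unfolding length_le_def
proof (intro allI impI)
  fix l assume "ideal_chain R J I l"
  then obtain u v where uv: "l \<le> u + v" "ideal_chain R (J \<inter> L) (I \<inter> L) u"
    "ideal_chain R (J <+> L) (I <+> L) v"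
    using ideal_chain_split assms by blast
  \<comment> \<open>For \<open>I \<subseteq> L \<subseteq> J\<close> the two chains run from
    \<open>I\<close> to \<open>L\<close> and from \<open>L\<close> to \<open>J\<close>.\<close>
  have "J <+> L = J" "I <+> L = L" "J \<inter> L = L" "I \<inter> L = I"
    using assms ideal_sum_least[OF assms(3), of J L] ideal_sum_left[OF assms(3,2)]
      ideal_sum_least[OF assms(2), of I L] ideal_sum_right[OF assms(1,2)] by auto
  then show "l \<le> a + b"
    using uv assms unfolding length_le_def by fastforce
qed

text \<open>The module \<open>(I + Ry)/I\<close> is cyclic, so a chain above \<open>A\<close> pulls
  back along \<open>r \<mapsto> r \<otimes> y\<close>. Strictness survives: a new element is
  \<open>i \<oplus> r \<otimes> y\<close> with \<open>i\<close> in \<open>I \<subseteq> A\<close>,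
  so \<open>r \<otimes> y\<close> is new as well.\<close>

lemma ideal_chain_colon:
  assumes "ideal I R" "y \<in> carrier R" "ideal A R" "I \<subseteq> A" "ideal_chain R (I <+> PIdl y) A l"
  shows "ideal_chain R (carrier R) {r \<in> carrier R. r \<otimes> y \<in> A} l"
  using assms(3-)
proof (induction l arbitrary: A)
  case (Suc l)
  then obtain L where L: "ideal L R" "A \<subset> L" "ideal_chain R (I <+> PIdl y) L l" by auto
  obtain z where z: "z \<in> L" "z \<notin> A" using L by blast
  have "z \<in> I <+> PIdl y" using z ideal_chain_subset[OF L(3)] by blast
  then obtain i r where ir: "i \<in> I" "r \<in> carrier R" "z = i \<oplus> r \<otimes> y"
    using mem_add_cgenideal_iff by auto
  have "r \<otimes> y \<in> L" using ideal_add_cancel[OF L(1), of i "r \<otimes> y"] ir z Suc.prems L assms(2) by auto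
  moreover have "r \<otimes> y \<notin> A" using ideal_add[OF Suc.prems(1)] ir z Suc.prems by auto
  ultimately have "{r \<in> carrier R. r \<otimes> y \<in> A} \<subset> {r \<in> carrier R. r \<otimes> y \<in> L}"
    using ir L by blast
  moreover have "ideal_chain R (carrier R) {r \<in> carrier R. r \<otimes> y \<in> L} l"
    using Suc.IH L Suc.prems by blast
  ultimately show ?case using ideal_colon[OF L(1) assms(2)] by auto
qed auto

text \<open>The quotient \<open>(I + Ry)/I\<close> is \<open>R/(I : y)\<close>, and
  \<open>I : y\<close> contains \<open>I + Rz\<close> because \<open>y \<otimes> z\<close> is in
  \<open>I\<close>. Additivity along \<open>I \<subseteq> I + Ry \<subseteq> R\<close> gives the
  bound.\<close>

lemma length_le_mult:
  assumes I: "ideal I R" and y: "y \<in> carrier R" and z: "z \<in> carrier R" and yz: "y \<otimes> z \<in> I"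
    and a: "length_le R (carrier R) (I <+> PIdl y) a"
    and b: "length_le R (carrier R) (I <+> PIdl z) b"
  shows "length_le R (carrier R) I (a + b)"
proof -
  have *: "I <+> PIdl z \<subseteq> {r \<in> carrier R. r \<otimes> y \<in> I}"
  proof (rule add_cgenideal_least)
    show "ideal {r \<in> carrier R. r \<otimes> y \<in> I} R" using ideal_colon I y .
    show "I \<subseteq> {r \<in> carrier R. r \<otimes> y \<in> I}"
      using I y ideal.Icarr ideal.I_r_closed by fastforce
    show "z \<in> {r \<in> carrier R. r \<otimes> y \<in> I}" using z y yz m_comm by auto
  qed
  have "length_le R (I <+> PIdl y) I b"
    unfolding length_le_def
  proof (intro allI impI)
    fix l assume "ideal_chain R (I <+> PIdl y) I l"
    then have "ideal_chain R (carrier R) {r \<in> carrier R. r \<otimes> y \<in> I} l"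
      using ideal_chain_colon[OF I y I] by blast
    then show "l \<le> b"
      using ideal_chain_antimono[OF _ *] b unfolding length_le_def by blast
  qed
  then have "length_le R (carrier R) I (b + a)"
    using length_le_add[OF I add_cgenideal_ideal[OF I y] oneideal] a
      add_cgenideal_subset[OF I y] ideal_subset[OF add_cgenideal_ideal[OF I y]] by blast
  then show ?thesis by (simp add: add.commute)
qed

lemma length_le_carrier: "length_le R (carrier R) (carrier R) 0"
  unfolding length_le_def
proof (intro allI impI)
  fix l assume "ideal_chain R (carrier R) (carrier R) l"
  then show "l \<le> 0"
    by (cases l) (auto dest: ideal_chain_subset)
qed

text \<open>Induction on \<open>n\<close>: \<open>length_le_mult\<close> with the factors
  \<open>x\<close> and \<open>x [^] n\<close> of \<open>x [^] Suc n\<close> adds one more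
  \<open>c\<close>. For \<open>n = 0\<close> the ideal is all of \<open>R\<close>, of colength
  \<open>0\<close>.\<close>

lemma length_le_pow:
  assumes I: "ideal I R" and x: "x \<in> carrier R"
    and c: "length_le R (carrier R) (I <+> PIdl x) c"
  shows "length_le R (carrier R) (I <+> PIdl (x [^] (n::nat))) (n * c)"
proof (induction n)
  case 0
  have "I <+> PIdl \<one> = carrier R"
    using add_cgenideal_ideal[OF I one_closed] add_cgenideal_self[OF I one_closed]
    by (simp add: ideal.one_imp_carrier)
  then show ?case using length_le_carrier by simp
next
  case (Suc n)
  let ?I = "I <+> PIdl (x [^] Suc n)"
  have id: "ideal ?I R" using add_cgenideal_ideal I x by auto
  have sub: "I <+> PIdl y \<subseteq> ?I <+> PIdl y" if "y \<in> carrier R" for y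
    using add_cgenideal_subset[OF I, of "x [^] Suc n"] add_cgenideal_subset[OF id that] x that id I
    by (intro add_cgenideal_least add_cgenideal_ideal add_cgenideal_self) auto
  have "length_le R (carrier R) ?I (c + n * c)"
  proof (rule length_le_mult[OF id x, of "x [^] n"])
    show "x \<otimes> x [^] n \<in> ?I"
      using add_cgenideal_self[OF I, of "x [^] Suc n"] x by (simp add: m_comm)
    show "length_le R (carrier R) (?I <+> PIdl x) c"
      using length_le_antimono[OF c sub[OF x]] .
    show "length_le R (carrier R) (?I <+> PIdl (x [^] n)) (n * c)"
      using length_le_antimono[OF Suc sub] x by simp
  qed (use x in auto)
  then show ?case by simp
qed

text \<open>Generators are raised to the power \<open>n\<close> one at a time, each at the price of
  a factor \<open>n\<close>. The set \<open>T\<close> holds the generators that are left alone. With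
  a system of parameters for \<open>S\<close> this gives growth of degree at most the
  dimension.\<close>

lemma length_le_gen_pow:
  assumes "finite S" "S \<subseteq> carrier R" "T \<subseteq> carrier R"
    and "length_le R (carrier R) (Idl (T \<union> S)) c"
  shows "length_le R (carrier R) (Idl (T \<union> (\<lambda>x. x [^] (n::nat)) ` S)) (n ^ card S * c)"
  using assms
proof (induction S arbitrary: T rule: finite_induct)
  case (insert x S)
  let ?p = "\<lambda>x. x [^] n"
  let ?A = "Idl (T \<union> ?p ` S)"
  have x: "x \<in> carrier R" and TS: "T \<union> ?p ` S \<subseteq> carrier R" using insert.prems by auto
  have A: "ideal ?A R" using genideal_ideal TS by blast
  \<comment> \<open>The induction hypothesis is used with \<open>x\<close> counted among the
    unchanged generators; only then is \<open>x\<close> itself raised to its power.\<close>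
  have "length_le R (carrier R) (Idl (insert x T \<union> ?p ` S)) (n ^ card S * c)"
    using insert.IH[of "insert x T"] insert.prems by auto
  moreover have "Idl (insert x T \<union> ?p ` S) \<subseteq> ?A <+> PIdl x"
    using add_cgenideal_self[OF A x] add_cgenideal_subset[OF A x] genideal_self[OF TS]
    by (intro genideal_minimal add_cgenideal_ideal[OF A x]) auto
  ultimately have "length_le R (carrier R) (?A <+> PIdl x) (n ^ card S * c)"
    by (rule length_le_antimono)
  then have "length_le R (carrier R) (?A <+> PIdl (x [^] n)) (n * (n ^ card S * c))"
    by (rule length_le_pow[OF A x])
  moreover have "?A <+> PIdl (x [^] n) \<subseteq> Idl (T \<union> ?p ` insert x S)"
  proof (rule add_cgenideal_least)
    have sub: "T \<union> ?p ` insert x S \<subseteq> carrier R" using TS x by auto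
    show "ideal (Idl (T \<union> ?p ` insert x S)) R" using genideal_ideal[OF sub] .
    show "?A \<subseteq> Idl (T \<union> ?p ` insert x S)"
      by (rule subset_Idl_subset[OF sub]) auto
    show "x [^] n \<in> Idl (T \<union> ?p ` insert x S)"
      using genideal_self[OF sub] by auto
  qed
  ultimately show ?case
    using insert.hyps length_le_antimono by (fastforce simp: mult.assoc)
qed simp

text \<open>Multiplication by \<open>x\<close> is injective from \<open>J\<close> modulo
  \<open>I\<close> to \<open>R\<close> modulo \<open>P\<close>, so it carries strict chains to
  strict chains. Indeed \<open>x \<otimes> z = p \<oplus> x \<otimes> a\<close> puts
  \<open>x \<otimes> (z \<ominus> a)\<close> in \<open>P\<close>, so \<open>z \<ominus> a\<close> is
  in \<open>I \<subseteq> A\<close>.\<close>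

lemma ideal_chain_image:
  assumes x: "x \<in> carrier R" and J: "ideal J R" and P: "ideal P R"
    and inj: "\<And>u. u \<in> J \<Longrightarrow> x \<otimes> u \<in> P \<Longrightarrow> u \<in> I"
    and "ideal A R" "I \<subseteq> A" "ideal_chain R J A l"
  shows "ideal_chain R (P <+> (x <# J)) (P <+> (x <# A)) l"
  using assms(5-)
proof (induction l arbitrary: A)
  case 0
  then show ?case by (simp add: set_add_mono l_coset_mono)
next
  case (Suc l)
  then obtain L where L: "ideal L R" "A \<subset> L" "ideal_chain R J L l" by auto
  obtain z where z: "z \<in> L" "z \<notin> A" using L by blast
  have zJ: "z \<in> J" and AJ: "A \<subseteq> J" using ideal_chain_subset[OF L(3)] z L(2) by auto
  have zc: "z \<in> carrier R" using ideal.Icarr[OF L(1) z(1)] .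
  have "x \<otimes> z \<notin> P <+> (x <# A)"
  proof
    assume "x \<otimes> z \<in> P <+> (x <# A)"
    then obtain p a where pa: "p \<in> P" "a \<in> A" "x \<otimes> z = p \<oplus> x \<otimes> a"
      by (auto simp: set_add_def' l_coset_def)
    have c: "a \<in> carrier R" "p \<in> carrier R"
      using ideal.Icarr[OF Suc.prems(1) pa(2)] ideal.Icarr[OF P pa(1)] by auto
    then have "x \<otimes> (z \<ominus> a) = p"
      using pa(3) x zc by (simp add: a_minus_def r_distr r_minus a_assoc r_neg)
    then have "z \<ominus> a \<in> I" using inj[of "z \<ominus> a"] pa zJ AJ J ideal_minus by auto
    then have "z \<in> A" using ideal_minus_cancel[OF Suc.prems(1) pa(2) zc] Suc.prems by auto
    then show False using z by blast
  qed
  moreover have "x \<otimes> z \<in> P <+> (x <# L)"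
    using ideal_sum_right[OF P ideal_l_coset[OF L(1) x]] z by (auto simp: l_coset_def)
  moreover have "P <+> (x <# A) \<subseteq> P <+> (x <# L)"
    using L by (simp add: set_add_mono l_coset_mono psubset_imp_subset)
  ultimately have "P <+> (x <# A) \<subset> P <+> (x <# L)" by blast
  moreover have "ideal_chain R (P <+> (x <# J)) (P <+> (x <# L)) l"
    using Suc.IH[OF L(1) _ L(3)] L Suc.prems by blast
  ultimately show ?case using add_ideals[OF P ideal_l_coset[OF L(1) x]] by auto
qed

lemma ideal_prod_least:
  assumes "ideal A R" and "\<And>i j. i \<in> I \<Longrightarrow> j \<in> J \<Longrightarrow> i \<otimes> j \<in> A"
  shows "I \<cdot> J \<subseteq> A"
proof
  fix s assume "s \<in> I \<cdot> J"
  then show "s \<in> A" by induction (use assms ideal_add in auto)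
qed

lemma nonprime_split:
  assumes "ideal I R" "I \<noteq> carrier R" "\<not> primeideal I R"
  obtains a b where "a \<in> carrier R" "b \<in> carrier R" "a \<otimes> b \<in> I" "a \<notin> I" "b \<notin> I"
  using ideal.primeidealCD[OF assms(1) is_cring assms(3)] assms(2) by metis

end

section \<open>Ascending chain condition and Noetherian induction\<close>

lemma (in noetherian_ring) ascending_ideals_stabilize:
  assumes id: "\<And>i. ideal (f i) R" and step: "\<And>i::nat. f i \<subseteq> f (Suc i)"
  shows "\<exists>N. \<forall>i\<ge>N. f i = f N"
proof -
  have mono: "f i \<subseteq> f j" if "i \<le> j" for i j
    using lift_Suc_mono_le[of f, OF step that] .
  have "subset.chain {I. ideal I R} (range f)"
    unfolding subset_chain_def
  proof (intro conjI ballI)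
    fix A B assume "A \<in> range f" "B \<in> range f"
    then obtain i j where "A = f i" "B = f j" by blast
    then show "A \<subseteq> B \<or> B \<subseteq> A"
      using mono[of i j] mono[of j i] by (cases "i \<le> j") auto
  qed (use id in auto)
  then have "\<Union>(range f) \<in> range f" by (simp add: ideal_chain_is_trivial)
  then obtain N where N: "\<Union>(range f) = f N" by auto
  have "f i = f N" if "N \<le> i" for i
    using mono[OF that] N by blast
  then show ?thesis by blast
qed

lemma (in noetherian_ring) wf_ideals: "wf {(J, I). ideal I R \<and> ideal J R \<and> I \<subset> J}"
proof (rule ccontr)
  assume "\<not> ?thesis"
  then obtain f where "\<forall>i. (f (Suc i), f i) \<in> {(J, I). ideal I R \<and> ideal J R \<and> I \<subset> J}"
    unfolding wf_iff_no_infinite_down_chain by blast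
  then have f: "\<And>i. ideal (f i) R" "\<And>i. f i \<subset> f (Suc i)"
    by simp_all
  have "\<exists>N. \<forall>i\<ge>N. f i = f N"
    by (rule ascending_ideals_stabilize) (use f in \<open>auto simp: psubset_eq\<close>)
  then obtain N where N: "\<forall>i\<ge>N. f i = f N" ..
  have "f (Suc N) = f N" using N by (meson le_Suc_eq order_refl)
  then show False using f(2)[of N] by blast
qed

section \<open>Noetherian local rings\<close>

lemma (in noetherian_ring) ideal_noetherian_induct [consumes 1, case_names step]:
  assumes "ideal I R"
    and "\<And>I. ideal I R \<Longrightarrow> (\<And>J. ideal J R \<Longrightarrow> I \<subset> J \<Longrightarrow> P J) \<Longrightarrow> P I"
  shows "P I"
  using wf_ideals assms(1)
proof (induction I rule: wf_induct_rule)
  case (less I)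
  show ?case by (rule assms(2)) (use less in auto)
qed

section \<open>Units, avoidance and Nakayama's lemma in a local ring\<close>

context noetherian_local_ring
begin

lemma M_ideal: "ideal M R"
  using maximal maximalideal.axioms(1) by blast

lemma M_prime: "primeideal M R"
  using maximal maximalideal_prime by blast

text \<open>Noetherian induction: a proper ideal that is not maximal sits strictly inside another
  proper ideal, and \<open>M\<close> is the only maximal one.\<close>

lemma proper_ideal_subset_M: "ideal I R \<Longrightarrow> I \<noteq> carrier R \<Longrightarrow> I \<subseteq> M"
proof (induction I rule: ideal_noetherian_induct)
  case (step I)
  show ?case
  proof (cases "maximalideal I R")
    case False
    then obtain J where J: "ideal J R" "I \<subseteq> J" "J \<noteq> I" "J \<noteq> carrier R"
      using maximalidealI[OF step.hyps] step.prems by metis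
    then have "J \<subseteq> M" using step.IH by blast
    then show ?thesis using J by blast
  qed (use maximal_unique in auto)
qed

lemma left_inverse_of_not_mem_M:
  assumes "a \<in> carrier R" "a \<notin> M"
  obtains b where "b \<in> carrier R" "b \<otimes> a = \<one>"
proof -
  have "PIdl a = carrier R"
    using proper_ideal_subset_M[OF cgenideal_ideal[OF assms(1)]] cgenideal_self assms by blast
  then have "\<one> \<in> PIdl a" by simp
  then show ?thesis using that by (auto simp: cgenideal_def)
qed

lemma prime_subset_M: "primeideal P R \<Longrightarrow> P \<subseteq> M"
  using proper_ideal_subset_M primeideal.I_notcarr primeideal.axioms(1) by blast

lemma ideal_mem_of_unit_mult:
  assumes I: "ideal I R" and u: "u \<in> carrier R" "u \<notin> M" and x: "x \<in> carrier R" "u \<otimes> x \<in> I"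
  shows "x \<in> I"
proof -
  obtain b where b: "b \<in> carrier R" "b \<otimes> u = \<one>"
    using left_inverse_of_not_mem_M u by blast
  then have "b \<otimes> (u \<otimes> x) = x" using u x by (simp flip: m_assoc)
  then show ?thesis using ideal.I_l_closed[OF I x(2) b(1)] by simp
qed

text \<open>Works for arbitrary ideals because the residue field is infinite. Take \<open>x\<close>
  in \<open>J\<close> outside all ideals but \<open>N\<close>, and \<open>y\<close> in
  \<open>J\<close> outside \<open>N\<close>. Each \<open>y \<oplus> r \<otimes> x\<close> avoids
  \<open>N\<close>, so it lies in some other \<open>N'\<close>. If \<open>r\<close> and
  \<open>r'\<close> share an \<open>N'\<close>, then \<open>(r \<ominus> r') \<otimes> x\<close> is
  in \<open>N'\<close> while \<open>x\<close> is not, so \<open>r \<ominus> r'\<close> is no unit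
  and the residues agree.\<close>

lemma ideal_avoidance:
  assumes inf: "infinite (carrier (R Quot M))"
    and "finite \<N>" and "\<And>N. N \<in> \<N> \<Longrightarrow> ideal N R" and J: "ideal J R" and "J \<subseteq> \<Union>\<N>"
  shows "\<exists>N\<in>\<N>. J \<subseteq> N"
  using assms(2,3,5)
proof (induction \<N> rule: finite_induct)
  case empty
  then show ?case using ideal_zero[OF J] by auto
next
  case (insert N \<N>)
  show ?case
  proof (rule ccontr)
    assume no: "\<not> ?thesis"
    then have "\<not> J \<subseteq> \<Union>\<N>" using insert by blast
    then obtain x where x: "x \<in> J" "x \<notin> \<Union>\<N>" by blast
    then have xN: "x \<in> N" using insert.prems by blast
    obtain y where y: "y \<in> J" "y \<notin> N" using no by blast
    have c: "x \<in> carrier R" "y \<in> carrier R" using x y ideal.Icarr[OF J] by auto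
    have idN: "ideal N R" using insert.prems by blast
    have mem: "\<exists>N'\<in>\<N>. y \<oplus> r \<otimes> x \<in> N'" if r: "r \<in> carrier R" for r
    proof -
      have rx: "r \<otimes> x \<in> N" "r \<otimes> x \<in> J" using ideal.I_l_closed[OF _ _ r] xN x J idN by auto
      then have "y \<oplus> r \<otimes> x \<in> J" using ideal_add[OF J] y by blast
      moreover have "y \<oplus> r \<otimes> x \<notin> N"
        using ideal_add_cancel[OF idN rx(1), of y] y c r by (auto simp: a_comm)
      ultimately show ?thesis using insert.prems by blast
    qed
    have same: "M +> r = M +> r'"
      if N': "N' \<in> \<N>" and r: "r \<in> carrier R" "r' \<in> carrier R"
        and m: "y \<oplus> r \<otimes> x \<in> N'" "y \<oplus> r' \<otimes> x \<in> N'" for r r' N'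
    proof -
      have id': "ideal N' R" using insert.prems N' by blast
      have "(y \<oplus> r \<otimes> x) \<ominus> (y \<oplus> r' \<otimes> x) = (r \<ominus> r') \<otimes> x"
        using c r by algebra
      then have "(r \<ominus> r') \<otimes> x \<in> N'" using ideal_minus[OF id' m] by simp
      then have "r \<ominus> r' \<in> M"
        using ideal_mem_of_unit_mult[OF id', of "r \<ominus> r'" x] r c x(2) N' by blast
      then show ?thesis using quotient_eq_iff_same_a_r_cos[OF M_ideal r] by blast
    qed
    \<comment> \<open>By \<open>same\<close> the residue class does not depend on the choice of
      \<open>r\<close>; by \<open>mem\<close> every class arises. So the finite set
      \<open>\<N>\<close> would cover the infinite residue field.\<close>
    define g where "g N' = M +> (SOME r. r \<in> carrier R \<and> y \<oplus> r \<otimes> x \<in> N')" for N'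
    have "carrier (R Quot M) \<subseteq> g ` \<N>"
    proof
      fix D assume "D \<in> carrier (R Quot M)"
      then obtain r where r: "r \<in> carrier R" "D = M +> r"
        by (auto simp: FactRing_def A_RCOSETS_def')
      then obtain N' where N': "N' \<in> \<N>" "y \<oplus> r \<otimes> x \<in> N'" using mem by blast
      let ?r = "SOME r. r \<in> carrier R \<and> y \<oplus> r \<otimes> x \<in> N'"
      have "?r \<in> carrier R \<and> y \<oplus> ?r \<otimes> x \<in> N'"
        by (rule someI[of _ r]) (use r N' in auto)
      then have "D = g N'" using same[OF N'(1) r(1), of ?r] N' r(2) by (auto simp: g_def)
      then show "D \<in> g ` \<N>" using N' by blast
    qed
    then show False using inf insert.hyps finite_subset by blast
  qed
qed

text \<open>Noetherian induction on \<open>A\<close>. If \<open>y\<close> in \<open>W\<close> is not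
  in \<open>A\<close>, then every \<open>A + Rz\<close> with \<open>z\<close> outside
  \<open>A\<close> already contains \<open>W\<close>. Applied to \<open>z = k \<otimes> y\<close>
  this would give \<open>(\<one> \<ominus> r \<otimes> k) \<otimes> y\<close> in \<open>A\<close>
  with a unit in front, so \<open>K y\<close> lies in \<open>A\<close>. Applied to
  \<open>z = y\<close> it gives \<open>K W \<subseteq> A\<close>, hence
  \<open>W \<subseteq> A\<close>.\<close>

lemma nakayama:
  assumes K: "ideal K R" "K \<subseteq> M" and W: "ideal W R"
    and A: "ideal A R" and sub: "W \<subseteq> A <+> (K \<cdot> W)"
  shows "W \<subseteq> A"
  using A sub
proof (induction A rule: ideal_noetherian_induct)
  case (step A)
  show ?case
  proof (rule ccontr)
    assume "\<not> W \<subseteq> A"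
    then obtain y where y: "y \<in> W" "y \<notin> A" by blast
    have yc: "y \<in> carrier R" using ideal.Icarr[OF W y(1)] .
    have big: "W \<subseteq> A <+> PIdl z" if z: "z \<in> carrier R" "z \<notin> A" for z
    proof (rule step.IH)
      show "A \<subset> A <+> PIdl z" using add_cgenideal_psubset[OF step.hyps z] .
      show "W \<subseteq> A <+> PIdl z <+> K \<cdot> W"
        using step.prems set_add_mono[OF add_cgenideal_subset[OF step.hyps z(1)] order_refl]
        by blast
    qed (use add_cgenideal_ideal step.hyps z in auto)
    have Ky: "k \<otimes> y \<in> A" if k: "k \<in> K" for k
    proof (rule ccontr)
      assume n: "k \<otimes> y \<notin> A"
      have kc: "k \<in> carrier R" using ideal.Icarr[OF K(1) k] .
      then have "y \<in> A <+> PIdl (k \<otimes> y)" using big n y yc by blast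
      then obtain a r where ar: "a \<in> A" "r \<in> carrier R" "y = a \<oplus> r \<otimes> (k \<otimes> y)"
        using mem_add_cgenideal_iff by auto
      have ac: "a \<in> carrier R" using ideal.Icarr[OF step.hyps ar(1)] .
      have "(\<one> \<ominus> r \<otimes> k) \<otimes> y = (a \<oplus> r \<otimes> (k \<otimes> y)) \<ominus> r \<otimes> k \<otimes> y"
        using ar(3) ar(2) kc yc by (simp add: a_minus_def l_distr l_minus)
      also have "\<dots> = a" using ac ar(2) kc yc by algebra
      finally have eq: "(\<one> \<ominus> r \<otimes> k) \<otimes> y = a" .
      have "r \<otimes> k \<in> M" using ideal.I_l_closed[OF M_ideal _ ar(2)] k K by blast
      then have "\<one> \<ominus> r \<otimes> k \<notin> M"
        using ideal_minus_cancel[OF M_ideal, of "r \<otimes> k" \<one>] ideal.one_imp_carrier[OF M_ideal]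
          maximalideal.I_notcarr[OF maximal] by auto
      then have "y \<in> A"
        using ideal_mem_of_unit_mult[OF step.hyps, of "\<one> \<ominus> r \<otimes> k" y] eq ar kc yc by auto
      then show False using y by blast
    qed
    have "K \<cdot> W \<subseteq> A"
    proof (rule ideal_prod_least[OF step.hyps])
      fix k w assume k: "k \<in> K" and w: "w \<in> W"
      have kc: "k \<in> carrier R" using ideal.Icarr[OF K(1) k] .
      obtain a r where ar: "a \<in> A" "r \<in> carrier R" "w = a \<oplus> r \<otimes> y"
        using big[OF yc y(2)] w mem_add_cgenideal_iff by blast
      have ac: "a \<in> carrier R" using ideal.Icarr[OF step.hyps ar(1)] .
      have "k \<otimes> w = k \<otimes> a \<oplus> r \<otimes> (k \<otimes> y)"
        unfolding ar(3) using kc ac ar(2) yc by algebra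
      moreover have "k \<otimes> a \<in> A" "r \<otimes> (k \<otimes> y) \<in> A"
        using ideal.I_l_closed[OF step.hyps] kc ar Ky[OF k] by auto
      ultimately show "k \<otimes> w \<in> A" using ideal_add[OF step.hyps] by simp
    qed
    then have "A <+> K \<cdot> W \<subseteq> A" using ideal_sum_least[OF step.hyps] by blast
    then show False using step.prems y by blast
  qed
qed

section \<open>Finite length, minimal primes and systems of parameters\<close>

lemma length_le_M: "length_le R (carrier R) M 1"
  unfolding length_le_def
proof (intro allI impI)
  fix l assume l: "ideal_chain R (carrier R) M l"
  show "l \<le> 1"
  proof (cases l)
    case (Suc k)
    then obtain L where L: "ideal L R" "M \<subset> L" "ideal_chain R (carrier R) L k" using l by auto
    then have "L = carrier R"
      using maximalideal.I_maximal[OF maximal L(1)] ideal_subset by blast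
    then have "k \<le> 0" using L(3) length_le_carrier unfolding length_le_def by blast
    then show ?thesis using Suc by simp
  qed simp
qed

text \<open>Noetherian induction: an ideal that is neither \<open>R\<close> nor prime contains a
  product of two elements outside it, and \<open>length_le_mult\<close> bounds its colength by those
  of the two larger ideals.\<close>

lemma finite_length:
  assumes "ideal Q R" and "\<And>P. primeideal P R \<Longrightarrow> Q \<subseteq> P \<Longrightarrow> P = M"
  shows "\<exists>c. length_le R (carrier R) Q c"
  using assms
proof (induction Q rule: ideal_noetherian_induct)
  case (step Q)
  consider "Q = carrier R" | "primeideal Q R" | "Q \<noteq> carrier R" "\<not> primeideal Q R" by blast
  then show ?case
  proof cases
    case 1
    then show ?thesis using length_le_carrier by blast
  next
    case 2
    then have "Q = M" using step.prems by blast
    then show ?thesis using length_le_M by blast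
  next
    case 3
    then obtain a b where ab: "a \<in> carrier R" "b \<in> carrier R" "a \<otimes> b \<in> Q" "a \<notin> Q" "b \<notin> Q"
      using nonprime_split[OF step.hyps] by blast
    have "\<exists>c. length_le R (carrier R) (Q <+> PIdl z) c" if z: "z \<in> carrier R" "z \<notin> Q" for z
    proof (rule step.IH)
      show "Q \<subset> Q <+> PIdl z" using add_cgenideal_psubset[OF step.hyps z] .
      then show "P = M" if "primeideal P R" "Q <+> PIdl z \<subseteq> P" for P
        using step.prems that by blast
    qed (use add_cgenideal_ideal step.hyps z in auto)
    then obtain u v where "length_le R (carrier R) (Q <+> PIdl a) u"
      "length_le R (carrier R) (Q <+> PIdl b) v"
      using ab(1,2,4,5) by meson
    then show ?thesis using length_le_mult[OF step.hyps ab(1-3)] by metis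
  qed
qed

text \<open>Same dichotomy as for finite length: if \<open>a \<otimes> b\<close> is in
  \<open>Q\<close>, each prime over \<open>Q\<close> contains \<open>a\<close> or \<open>b\<close>,
  so the lists for the two larger ideals together serve \<open>Q\<close>. The list need not be
  irredundant.\<close>

lemma minimal_primes:
  assumes "ideal Q R"
  shows "\<exists>\<P>. finite \<P> \<and> (\<forall>P\<in>\<P>. primeideal P R) \<and>
    (\<forall>P. primeideal P R \<longrightarrow> Q \<subseteq> P \<longrightarrow> (\<exists>P0\<in>\<P>. Q \<subseteq> P0 \<and> P0 \<subseteq> P))"
  using assms
proof (induction Q rule: ideal_noetherian_induct)
  case (step Q)
  consider "Q = carrier R" | "primeideal Q R" | "Q \<noteq> carrier R" "\<not> primeideal Q R" by blast
  then show ?case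
  proof cases
    case 1
    have "\<not> Q \<subseteq> P" if "primeideal P R" for P
      using 1 primeideal.I_notcarr[OF that] ideal_subset[OF primeideal.axioms(1)[OF that]] by blast
    then show ?thesis by (intro exI[of _ "{}"]) auto
  next
    case 2
    then show ?thesis by (intro exI[of _ "{Q}"]) auto
  next
    case 3
    then obtain a b where ab: "a \<in> carrier R" "b \<in> carrier R" "a \<otimes> b \<in> Q" "a \<notin> Q" "b \<notin> Q"
      using nonprime_split[OF step.hyps] by blast
    have *: "Q \<subset> Q <+> PIdl z" "ideal (Q <+> PIdl z) R" if "z \<in> carrier R" "z \<notin> Q" for z
      using add_cgenideal_psubset[OF step.hyps that] add_cgenideal_ideal[OF step.hyps that(1)] by auto
    obtain \<A> where \<A>: "finite \<A>" "\<forall>P\<in>\<A>. primeideal P R"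
      "\<forall>P. primeideal P R \<longrightarrow> Q <+> PIdl a \<subseteq> P \<longrightarrow> (\<exists>P0\<in>\<A>. Q <+> PIdl a \<subseteq> P0 \<and> P0 \<subseteq> P)"
      using step.IH[OF *(2,1)[OF ab(1,4)]] by (elim exE conjE)
    obtain \<B> where \<B>: "finite \<B>" "\<forall>P\<in>\<B>. primeideal P R"
      "\<forall>P. primeideal P R \<longrightarrow> Q <+> PIdl b \<subseteq> P \<longrightarrow> (\<exists>P0\<in>\<B>. Q <+> PIdl b \<subseteq> P0 \<and> P0 \<subseteq> P)"
      using step.IH[OF *(2,1)[OF ab(2,5)]] by (elim exE conjE)
    show ?thesis
    proof (intro exI[of _ "\<A> \<union> \<B>"] conjI allI impI)
      fix P assume P: "primeideal P R" "Q \<subseteq> P"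
      then have "a \<in> P \<or> b \<in> P" using primeideal.I_prime[OF P(1)] ab by blast
      then show "\<exists>P0\<in>\<A> \<union> \<B>. Q \<subseteq> P0 \<and> P0 \<subseteq> P"
      proof
        assume "a \<in> P"
        then obtain P0 where "P0 \<in> \<A>" "Q <+> PIdl a \<subseteq> P0" "P0 \<subseteq> P"
          using \<A>(3)[rule_format, OF P(1)] add_cgenideal_least[OF primeideal.axioms(1)[OF P(1)] P(2)] by blast
        then show ?thesis using *(1)[OF ab(1,4)] by blast
      next
        assume "b \<in> P"
        then obtain P0 where "P0 \<in> \<B>" "Q <+> PIdl b \<subseteq> P0" "P0 \<subseteq> P"
          using \<B>(3)[rule_format, OF P(1)] add_cgenideal_least[OF primeideal.axioms(1)[OF P(1)] P(2)] by blast
        then show ?thesis using *(1)[OF ab(2,5)] by blast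
      qed
    qed (use \<A> \<B> in auto)
  qed
qed

text \<open>Generic choice of parameters. Pick \<open>x\<close> in \<open>K\<close> outside the
  listed primes over \<open>Q\<close> other than \<open>M\<close>, and recurse on
  \<open>Q + Rx\<close>. A prime \<open>C 0\<close> over \<open>Q + Rx\<close> contains a listed
  prime over \<open>Q\<close>, which misses \<open>x\<close>; this lengthens the chain by one at the
  bottom.\<close>

lemma prime_chain_avoiding:
  assumes inf: "infinite (carrier (R Quot M))" and K: "ideal K R"
    and KM: "\<forall>P. primeideal P R \<longrightarrow> K \<subseteq> P \<longrightarrow> P = M" and "ideal Q R"
  shows "\<exists>S. finite S \<and> S \<subseteq> K \<and> card S \<le> n \<and>
    (\<forall>P. primeideal P R \<longrightarrow> Q \<subseteq> P \<longrightarrow> S \<subseteq> P \<longrightarrow> P \<noteq> M \<longrightarrow>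
      (\<exists>C :: nat \<Rightarrow> 'a set. (\<forall>i\<le>n. primeideal (C i) R) \<and> (\<forall>i<n. C i \<subset> C (Suc i)) \<and>
        C n = P \<and> Q \<subseteq> C 0))"
  using assms(4)
proof (induction n arbitrary: Q)
  case 0
  show ?case
  proof (intro exI[of _ "{}"] conjI allI impI)
    fix P assume "primeideal P R" "Q \<subseteq> P"
    then show "\<exists>C :: nat \<Rightarrow> 'a set. (\<forall>i\<le>0. primeideal (C i) R) \<and> (\<forall>i<0. C i \<subset> C (Suc i)) \<and>
        C 0 = P \<and> Q \<subseteq> C 0"
      by (intro exI[of _ "\<lambda>_. P"]) auto
  qed auto
next
  case (Suc n)
  obtain \<P> where \<P>: "finite \<P>" "\<forall>P\<in>\<P>. primeideal P R"
    "\<forall>P. primeideal P R \<longrightarrow> Q \<subseteq> P \<longrightarrow> (\<exists>P0\<in>\<P>. Q \<subseteq> P0 \<and> P0 \<subseteq> P)"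
    using minimal_primes[OF Suc.prems] by (elim exE conjE)
  have "\<not> K \<subseteq> \<Union>(\<P> - {M})"
  proof
    assume "K \<subseteq> \<Union>(\<P> - {M})"
    then have "\<exists>N\<in>\<P> - {M}. K \<subseteq> N"
      using \<P>(1,2) by (intro ideal_avoidance[OF inf _ _ K]) (auto intro: primeideal.axioms(1))
    then show False using KM \<P>(2) by auto
  qed
  then obtain x where x: "x \<in> K" "x \<notin> \<Union>(\<P> - {M})" by blast
  have xc: "x \<in> carrier R" using ideal.Icarr[OF K x(1)] .
  obtain S where S: "finite S" "S \<subseteq> K" "card S \<le> n"
    "\<forall>P. primeideal P R \<longrightarrow> Q <+> PIdl x \<subseteq> P \<longrightarrow> S \<subseteq> P \<longrightarrow> P \<noteq> M \<longrightarrow>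
      (\<exists>C :: nat \<Rightarrow> 'a set. (\<forall>i\<le>n. primeideal (C i) R) \<and> (\<forall>i<n. C i \<subset> C (Suc i)) \<and>
        C n = P \<and> Q <+> PIdl x \<subseteq> C 0)"
    using Suc.IH[OF add_cgenideal_ideal[OF Suc.prems xc]] by (elim exE conjE)
  show ?case
  proof (intro exI[of _ "insert x S"] conjI allI impI)
    show "card (insert x S) \<le> Suc n" using S card_insert_le_m1 by (simp add: card_insert_if)
    fix P assume P: "primeideal P R" "Q \<subseteq> P" "insert x S \<subseteq> P" "P \<noteq> M"
    have "Q <+> PIdl x \<subseteq> P"
      using add_cgenideal_least[OF primeideal.axioms(1)[OF P(1)] P(2)] P(3) by blast
    then obtain C :: "nat \<Rightarrow> 'a set" where C: "\<forall>i\<le>n. primeideal (C i) R" "\<forall>i<n. C i \<subset> C (Suc i)"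
      "C n = P" "Q <+> PIdl x \<subseteq> C 0"
      using S(4)[rule_format, OF P(1)] P by auto
    have QC: "Q \<subseteq> C 0" "x \<in> C 0"
      using C(4) add_cgenideal_subset[OF Suc.prems xc] add_cgenideal_self[OF Suc.prems xc] by auto
    obtain P0 where P0: "P0 \<in> \<P>" "Q \<subseteq> P0" "P0 \<subseteq> C 0"
      using \<P>(3)[rule_format, of "C 0"] C(1) QC by blast
    have CP: "C i \<subseteq> P" if "i \<le> n" for i
      using that
    proof (induction rule: inc_induct)
      case (step i)
      then show ?case using C(2) by blast
    qed (use C in auto)
    have "P \<subseteq> M" using P(1) prime_subset_M by blast
    \<comment> \<open>The element \<open>x\<close> avoids only the members of \<open>\<P>\<close>
      different from \<open>M\<close>, so \<open>P0\<close> must be told apart from \<open>M\<close>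
      before \<open>x\<close> separates it from \<open>C 0\<close>.\<close>
    then have "P0 \<noteq> M" using P0 CP[of 0] P(4) by blast
    then have "P0 \<subset> C 0" using x(2) P0 QC by blast
    then show "\<exists>C :: nat \<Rightarrow> 'a set. (\<forall>i\<le>Suc n. primeideal (C i) R) \<and>
        (\<forall>i<Suc n. C i \<subset> C (Suc i)) \<and> C (Suc n) = P \<and> Q \<subseteq> C 0"
      using C P0 \<P>(2)
      by (intro exI[of _ "\<lambda>i. case i of 0 \<Rightarrow> P0 | Suc j \<Rightarrow> C j"])
         (auto split: nat.splits simp: less_Suc_eq_0_disj)
  qed (use S x in auto)
qed

lemma system_of_parameters:
  assumes inf: "infinite (carrier (R Quot M))" and K: "ideal K R"
    and KM: "\<forall>P. primeideal P R \<longrightarrow> K \<subseteq> P \<longrightarrow> P = M" and d: "krull_dim R = enat d"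
  obtains S where "finite S" "S \<subseteq> K" "card S \<le> d" "\<And>P. primeideal P R \<Longrightarrow> S \<subseteq> P \<Longrightarrow> P = M"
proof -
  obtain S where S: "finite S" "S \<subseteq> K" "card S \<le> d"
    "\<forall>P. primeideal P R \<longrightarrow> {\<zero>} \<subseteq> P \<longrightarrow> S \<subseteq> P \<longrightarrow> P \<noteq> M \<longrightarrow>
      (\<exists>C :: nat \<Rightarrow> 'a set. (\<forall>i\<le>d. primeideal (C i) R) \<and> (\<forall>i<d. C i \<subset> C (Suc i)) \<and>
        C d = P \<and> {\<zero>} \<subseteq> C 0)"
    using prime_chain_avoiding[OF inf K KM zeroideal, of d] by (elim exE conjE)
  have "P = M" if P: "primeideal P R" "S \<subseteq> P" for P
  proof (rule ccontr)
    assume "P \<noteq> M"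
    then obtain C :: "nat \<Rightarrow> 'a set" where C: "\<forall>i\<le>d. primeideal (C i) R" "\<forall>i<d. C i \<subset> C (Suc i)"
      "C d = P"
      using S(4)[rule_format, OF P(1) _ P(2)] ideal_zero[OF primeideal.axioms(1)[OF P(1)]] by auto
    \<comment> \<open>Putting \<open>M\<close> on top gives a chain of \<open>d + 2\<close> primes,
      contradicting dimension \<open>d\<close>.\<close>
    define C' where "C' i = (if i \<le> d then C i else M)" for i
    have "\<forall>i\<le>Suc d. primeideal (C' i) R" using C M_prime by (simp add: C'_def)
    moreover have "C' i \<subset> C' (Suc i)" if "i < Suc d" for i
      using that C prime_subset_M[OF P(1)] \<open>P \<noteq> M\<close> by (cases "i = d") (auto simp: C'_def)
    ultimately have "enat (Suc d) \<in> {enat n | n. \<exists>P :: nat \<Rightarrow> 'a set.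
        (\<forall>i\<le>n. primeideal (P i) R) \<and> (\<forall>i<n. P i \<subset> P (Suc i))}" by blast
    then have "enat (Suc d) \<le> krull_dim R" unfolding krull_dim_def by (rule Sup_upper)
    then show False using d by simp
  qed
  then show ?thesis using that S by blast
qed

text \<open>The constant \<open>c\<close> bounds the colength of the ideal generated by a system of
  parameters chosen in \<open>K\<close>; \<open>L\<close> contains the \<open>N\<close>-th powers of
  these parameters. It will be applied to \<open>L = K^N\<close>.\<close>

lemma length_le_of_powers:
  assumes "infinite (carrier (R Quot M))" "ideal K R"
    and "\<forall>P. primeideal P R \<longrightarrow> K \<subseteq> P \<longrightarrow> P = M" and "krull_dim R = enat d"
  obtains c where "\<And>N L. 1 \<le> N \<Longrightarrow> ideal L R \<Longrightarrow> (\<And>x. x \<in> K \<Longrightarrow> x [^] (N::nat) \<in> L) \<Longrightarrow>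
      length_le R (carrier R) L (N ^ d * c)"
proof -
  obtain S where S: "finite S" "S \<subseteq> K" "card S \<le> d" "\<And>P. primeideal P R \<Longrightarrow> S \<subseteq> P \<Longrightarrow> P = M"
    using system_of_parameters[OF assms] by metis
  have Sc: "S \<subseteq> carrier R" using S(2) ideal_subset[OF assms(2)] by blast
  have "\<exists>c. length_le R (carrier R) (Idl S) c"
    using finite_length[OF genideal_ideal[OF Sc]] S(4) genideal_self[OF Sc] by blast
  then obtain c where c: "length_le R (carrier R) (Idl S) c" by blast
  have "length_le R (carrier R) L (N ^ d * c)"
    if N: "1 \<le> N" and L: "ideal L R" "\<And>x. x \<in> K \<Longrightarrow> x [^] (N::nat) \<in> L" for N L
  proof -
    have "length_le R (carrier R) (Idl ({} \<union> (\<lambda>x. x [^] N) ` S)) (N ^ card S * c)"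
      using length_le_gen_pow[OF S(1) Sc, of "{}" c N] c by simp
    moreover have "Idl ({} \<union> (\<lambda>x. x [^] N) ` S) \<subseteq> L"
      using L S(2) by (intro genideal_minimal) auto
    \<comment> \<open>The system may have fewer than \<open>d\<close> elements;
      \<open>N \<ge> 1\<close> allows the exponent to be raised to \<open>d\<close>.\<close>
    moreover have "N ^ card S * c \<le> N ^ d * c" using N S(3) by (simp add: power_increasing)
    ultimately show ?thesis using length_le_mono length_le_antimono by blast
  qed
  then show ?thesis using that by blast
qed

end

section \<open>Multigraded products of ideals\<close>

definition unit_vec :: "'s \<Rightarrow> 's \<Rightarrow> nat" where
  "unit_vec i = (\<lambda>k. if k = i then 1 else 0)"

lemma fun_add_diff_nat: "n \<le> k \<Longrightarrow> n + (k - n) = (k :: 's \<Rightarrow> nat)"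
  by (auto simp: le_fun_def fun_eq_iff)

lemma unit_vec_le_iff: "unit_vec i \<le> n \<longleftrightarrow> 1 \<le> n i"
  by (auto simp: le_fun_def unit_vec_def)

lemma finite_atMost_fun: "finite {n. n \<le> (w :: 's::finite \<Rightarrow> nat)}"
proof -
  have "{n. n \<le> w} \<subseteq> PiE UNIV (\<lambda>i. {..w i})"
    by (auto simp: PiE_def le_fun_def)
  then show ?thesis by (rule finite_subset) (simp add: finite_PiE)
qed

text \<open>An abstract form of the family \<open>J(n)\<close> on natural multidegrees;
  \<open>mpow_multigraded_ideals\<close> supplies the instance.\<close>

locale multigraded_ideals = noetherian_local_ring +
  fixes W :: "('s::finite \<Rightarrow> nat) \<Rightarrow> 'a set"
  assumes W_ideal: "ideal (W n) R"
    and W_zero: "W 0 = carrier R"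
    and W_add: "W (n + m) = W n \<cdot> W m"
begin

text \<open>
  A subfamily \<open>Q\<close> stands for the homogeneous ideal \<open>\<Oplus>\<^sub>n Q(n) t\<^sup>n\<close> of the multigraded Rees algebra
  \<open>\<Oplus>\<^sub>n W(n) t\<^sup>n\<close>.
\<close>

definition homogeneous_ideal :: "(('s \<Rightarrow> nat) \<Rightarrow> 'a set) \<Rightarrow> bool" where
  "homogeneous_ideal Q \<longleftrightarrow> (\<forall>n. ideal (Q n) R) \<and> (\<forall>n. Q n \<subseteq> W n) \<and>
     (\<forall>n m. \<forall>a\<in>W n. \<forall>b\<in>Q m. a \<otimes> b \<in> Q (n + m))"

text \<open>
  Primality is only demanded in the window of degrees below \<open>w\<close>.  The window being finite, the
  ascending chain condition for \<open>R\<close> suffices and the Rees algebra need not be shown to be Noetherian.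
\<close>

definition relevant_prime :: "('s \<Rightarrow> nat) \<Rightarrow> (('s \<Rightarrow> nat) \<Rightarrow> 'a set) \<Rightarrow> bool" where
  "relevant_prime w P \<longleftrightarrow> homogeneous_ideal P \<and> \<not> W w \<subseteq> P w \<and>
     (\<forall>n m. n + m \<le> w \<longrightarrow> (\<forall>a\<in>W n. \<forall>b\<in>W m. a \<otimes> b \<in> P (n + m) \<longrightarrow> a \<in> P n \<or> b \<in> P m))"

text \<open>Restricted to the window, containment involves finitely many ideals of \<open>R\<close>,
  so ascending sequences stabilise.\<close>

definition subset_upto ::
  "('s \<Rightarrow> nat) \<Rightarrow> (('s \<Rightarrow> nat) \<Rightarrow> 'a set) \<Rightarrow> (('s \<Rightarrow> nat) \<Rightarrow> 'a set) \<Rightarrow> bool" where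
  "subset_upto w Q P \<longleftrightarrow> (\<forall>n\<le>w. Q n \<subseteq> P n)"

text \<open>The homogeneous ideal generated by \<open>Q\<close> and the monomial of coefficient
  \<open>a\<close> in degree \<open>n\<close>. The case distinction guards against truncated
  subtraction in \<open>k - n\<close>.\<close>

definition adjoin ::
  "(('s \<Rightarrow> nat) \<Rightarrow> 'a set) \<Rightarrow> ('s \<Rightarrow> nat) \<Rightarrow> 'a \<Rightarrow> ('s \<Rightarrow> nat) \<Rightarrow> 'a set" where
  "adjoin Q n a k = Q k <+> (if n \<le> k then a <# W (k - n) else {\<zero>})"

section \<open>Homogeneous ideals and adjunction of a homogeneous element\<close>

lemma W_carr: "a \<in> W n \<Longrightarrow> a \<in> carrier R"
  using ideal.Icarr[OF W_ideal] .

lemma W_mult: "a \<in> W n \<Longrightarrow> b \<in> W m \<Longrightarrow> a \<otimes> b \<in> W (n + m)"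
  by (simp add: W_add ideal_prod.prod)

lemma W_antimono:
  assumes "n \<le> m"
  shows "W m \<subseteq> W n"
  using W_add[of n "m - n"] ideal_prod_inter[OF W_ideal W_ideal, of n "m - n"]
  unfolding fun_add_diff_nat[OF assms] by blast

lemma W_add_least:
  assumes "ideal A R" and "\<And>a b. a \<in> W n \<Longrightarrow> b \<in> W m \<Longrightarrow> a \<otimes> b \<in> A"
  shows "W (n + m) \<subseteq> A"
  unfolding W_add using ideal_prod_least[OF assms] by blast

lemma subset_upto_refl: "subset_upto w Q Q"
  by (simp add: subset_upto_def)

lemma subset_upto_trans: "subset_upto w Q Q' \<Longrightarrow> subset_upto w Q' Q'' \<Longrightarrow> subset_upto w Q Q''"
  unfolding subset_upto_def by blast

lemma homogeneous_ideal_ideal: "homogeneous_ideal Q \<Longrightarrow> ideal (Q n) R"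
  by (simp add: homogeneous_ideal_def)

lemma homogeneous_ideal_subset: "homogeneous_ideal Q \<Longrightarrow> Q n \<subseteq> W n"
  by (simp add: homogeneous_ideal_def)

lemma homogeneous_ideal_mult:
  "homogeneous_ideal Q \<Longrightarrow> a \<in> W n \<Longrightarrow> b \<in> Q m \<Longrightarrow> a \<otimes> b \<in> Q (n + m)"
  by (simp add: homogeneous_ideal_def)

lemma homogeneous_ideal_mult':
  assumes "homogeneous_ideal Q" "a \<in> Q n" "b \<in> W m"
  shows "a \<otimes> b \<in> Q (n + m)"
  using homogeneous_ideal_mult[OF assms(1,3,2)] m_comm[OF W_carr W_carr, of a n b m]
    homogeneous_ideal_subset[OF assms(1)] assms(2,3) by (metis add.commute subsetD)

text \<open>\<open>W m\<close> is the product of \<open>W n\<close> and \<open>W (m - n)\<close>, so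
  an ideal filling one degree fills all larger ones. A relevant prime is therefore proper in every
  degree of its window.\<close>

lemma homogeneous_ideal_top_mono:
  assumes "homogeneous_ideal Q" "W n \<subseteq> Q n" "n \<le> m"
  shows "W m \<subseteq> Q m"
proof -
  have "W (n + (m - n)) \<subseteq> Q (n + (m - n))"
    by (rule W_add_least[OF homogeneous_ideal_ideal[OF assms(1)]])
       (use assms(2) homogeneous_ideal_mult'[OF assms(1)] in blast)
  then show ?thesis using fun_add_diff_nat[OF assms(3)] by simp
qed

lemma relevant_prime_proper:
  assumes "relevant_prime w P" "n \<le> w"
  shows "\<not> W n \<subseteq> P n"
  using assms homogeneous_ideal_top_mono[of P n w] by (auto simp: relevant_prime_def)

lemma adjoin_ideal:
  assumes "homogeneous_ideal Q" "a \<in> W n"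
  shows "ideal (adjoin Q n a k) R"
  using assms W_carr by (simp add: adjoin_def add_ideals homogeneous_ideal_ideal ideal_l_coset W_ideal zeroideal)

lemma adjoin_cases:
  assumes "homogeneous_ideal Q" "z \<in> adjoin Q n a k"
  obtains (base) "z \<in> Q k" | (step) q c where "n \<le> k" "q \<in> Q k" "c \<in> W (k - n)" "z = q \<oplus> a \<otimes> c"
proof (cases "n \<le> k")
  case True
  then show ?thesis using assms(2) that(2) by (auto simp: adjoin_def set_add_def' l_coset_def)
next
  case False
  then have "z \<in> Q k"
    using assms(2) ideal.Icarr[OF homogeneous_ideal_ideal[OF assms(1)]]
    by (auto simp: adjoin_def set_add_def')
  then show ?thesis using that by blast
qed

lemma adjoin_subset: "homogeneous_ideal Q \<Longrightarrow> a \<in> W n \<Longrightarrow> Q k \<subseteq> adjoin Q n a k"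
  unfolding adjoin_def
  by (rule ideal_sum_left) (auto simp: homogeneous_ideal_ideal ideal_l_coset W_ideal zeroideal W_carr)

lemma adjoin_mult_mem:
  assumes "homogeneous_ideal Q" "a \<in> W n" "n \<le> k" "c \<in> W (k - n)"
  shows "a \<otimes> c \<in> adjoin Q n a k"
proof -
  have "a <# W (k - n) \<subseteq> adjoin Q n a k"
    using ideal_sum_right[OF homogeneous_ideal_ideal[OF assms(1)] ideal_l_coset[OF W_ideal W_carr[OF assms(2)]]]
      assms(3) by (simp add: adjoin_def)
  then show ?thesis using assms(4) by (auto simp: l_coset_def)
qed

lemma adjoin_self:
  assumes "homogeneous_ideal Q" "a \<in> W n"
  shows "a \<in> adjoin Q n a n"
proof -
  have "n - n = 0" by (simp add: fun_eq_iff)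
  then show ?thesis
    using adjoin_mult_mem[OF assms, of n \<one>] W_carr[OF assms(2)] W_zero by simp
qed

lemma adjoin_homogeneous_ideal:
  assumes Q: "homogeneous_ideal Q" and a: "a \<in> W n"
  shows "homogeneous_ideal (adjoin Q n a)"
  unfolding homogeneous_ideal_def
proof (intro conjI allI ballI)
  show "ideal (adjoin Q n a k) R" for k using adjoin_ideal[OF assms] .
  show "adjoin Q n a k \<subseteq> W k" for k
  proof
    fix z assume "z \<in> adjoin Q n a k"
    with Q show "z \<in> W k"
    proof (cases rule: adjoin_cases)
      case base
      then show ?thesis using homogeneous_ideal_subset[OF Q] by blast
    next
      case (step q c)
      then have "a \<otimes> c \<in> W k" using W_mult[OF a step(3)] fun_add_diff_nat by metis
      then show ?thesis using ideal_add[OF W_ideal] step homogeneous_ideal_subset[OF Q] by blast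
    qed
  qed
  fix m k b z assume b: "b \<in> W m" and z: "z \<in> adjoin Q n a k"
  from Q z show "b \<otimes> z \<in> adjoin Q n a (m + k)"
  proof (cases rule: adjoin_cases)
    case base
    then show ?thesis using adjoin_subset[OF assms] homogeneous_ideal_mult[OF Q b] by blast
  next
    case (step q c)
    have le: "n \<le> m + k" using step(1) by (auto simp: le_fun_def intro: trans_le_add2)
    have eq: "m + (k - n) = (m + k) - n" using step(1) by (auto simp: le_fun_def fun_eq_iff)
    have "b \<otimes> c \<in> W ((m + k) - n)" using W_mult[OF b step(3)] eq by simp
    then have "a \<otimes> (b \<otimes> c) \<in> adjoin Q n a (m + k)" using adjoin_mult_mem[OF assms le] by blast
    moreover have "b \<otimes> q \<in> adjoin Q n a (m + k)"
      using adjoin_subset[OF assms] homogeneous_ideal_mult[OF Q b step(2)] by blast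
    moreover have "b \<otimes> z = b \<otimes> q \<oplus> a \<otimes> (b \<otimes> c)"
      using W_carr[OF a] W_carr[OF b] W_carr[OF step(3)] ideal.Icarr[OF homogeneous_ideal_ideal[OF Q] step(2)]
      unfolding step(4) by algebra
    ultimately show ?thesis using ideal_add[OF adjoin_ideal[OF assms]] by metis
  qed
qed

lemma adjoin_least:
  assumes P: "homogeneous_ideal P" and QP: "subset_upto w Q P" and a: "a \<in> P n"
  shows "subset_upto w (adjoin Q n a) P"
  unfolding subset_upto_def
proof (intro allI impI)
  fix k assume k: "k \<le> w"
  show "adjoin Q n a k \<subseteq> P k"
  proof (cases "n \<le> k")
    case True
    have "a <# W (k - n) \<subseteq> P k"
      using homogeneous_ideal_mult'[OF P a] fun_add_diff_nat[OF True] by (fastforce simp: l_coset_def)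
    then show ?thesis
      using True QP k ideal_sum_least[OF homogeneous_ideal_ideal[OF P]]
      by (simp add: adjoin_def subset_upto_def)
  next
    case False
    then show ?thesis
      using QP k ideal_sum_least[OF homogeneous_ideal_ideal[OF P]] ideal_zero[OF homogeneous_ideal_ideal[OF P]]
      by (simp add: adjoin_def subset_upto_def)
  qed
qed

text \<open>Each of the finitely many degrees below \<open>w\<close> stabilises separately; the
  maximum of the indices works for the whole window.\<close>

lemma wf_homogeneous_ideals:
  "wf {(Q', Q). homogeneous_ideal Q \<and> homogeneous_ideal Q' \<and> subset_upto w Q Q' \<and> \<not> subset_upto w Q' Q}"
    (is "wf ?r")
proof (rule ccontr)
  assume "\<not> wf ?r"
  then obtain f where "\<forall>i. (f (Suc i), f i) \<in> ?r"
    unfolding wf_iff_no_infinite_down_chain by blast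
  then have f: "\<And>i. homogeneous_ideal (f i)" "\<And>i n. n \<le> w \<Longrightarrow> f i n \<subseteq> f (Suc i) n"
    "\<And>i. \<not> subset_upto w (f (Suc i)) (f i)"
    by (auto simp: subset_upto_def)
  have "\<exists>N. \<forall>i\<ge>N. f i n = f N n" if "n \<le> w" for n
    by (rule ascending_ideals_stabilize[of "\<lambda>i. f i n"])
       (use f(2)[OF that] homogeneous_ideal_ideal[OF f(1)] in auto)
  then obtain N where N: "\<And>n i. n \<le> w \<Longrightarrow> N n \<le> i \<Longrightarrow> f i n = f (N n) n" by metis
  define K where "K = Max (N ` {n. n \<le> w})"
  have "N n \<le> K" if "n \<le> w" for n
    unfolding K_def using that finite_atMost_fun[of w] by (intro Max_ge) auto
  then have "f (Suc K) n = f K n" if "n \<le> w" for n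
    using N[OF that, of K] N[OF that, of "Suc K"] that by (metis le_SucI)
  then have "subset_upto w (f (Suc K)) (f K)" by (simp add: subset_upto_def)
  then show False using f(3) by blast
qed

section \<open>Existence and finiteness of relevant primes\<close>

lemma homogeneous_ideal_split:
  assumes Q: "homogeneous_ideal Q" and "\<not> W w \<subseteq> Q w" and "\<not> relevant_prime w Q"
  obtains n m a b where "n + m \<le> w" "n \<le> w" "m \<le> w" "a \<in> W n" "b \<in> W m" "a \<otimes> b \<in> Q (n + m)"
    "a \<notin> Q n" "b \<notin> Q m"
proof -
  obtain n m a b where *: "n + m \<le> w" "a \<in> W n" "b \<in> W m" "a \<otimes> b \<in> Q (n + m)" "a \<notin> Q n" "b \<notin> Q m"
    using assms unfolding relevant_prime_def by blast
  moreover have "n \<le> w" "m \<le> w" using *(1) by (auto simp: le_fun_def dest: add_leD1 add_leD2)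
  ultimately show ?thesis using that by blast
qed

lemma adjoin_descent:
  assumes "homogeneous_ideal Q" "a \<in> W n" "a \<notin> Q n" "n \<le> w"
  shows "(adjoin Q n a, Q) \<in>
    {(Q', Q). homogeneous_ideal Q \<and> homogeneous_ideal Q' \<and> subset_upto w Q Q' \<and> \<not> subset_upto w Q' Q}"
  using assms adjoin_homogeneous_ideal adjoin_subset adjoin_self by (fastforce simp: subset_upto_def)

text \<open>If \<open>Q\<close> is not prime in the window, take \<open>a\<close>, \<open>b\<close>
  outside \<open>Q\<close> with product in \<open>Q\<close>. Without a relevant prime above
  \<open>Q\<close>, adjoining \<open>a\<close> fills some degree \<open>k\<close> and adjoining
  \<open>b\<close> some degree \<open>l\<close>. Then \<open>Q\<close> fills \<open>k + l\<close>,
  since \<open>(q + a c)(q' + b c')\<close> is in \<open>Q\<close>. The degrees \<open>k\<close> and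
  \<open>l\<close> may leave the window.\<close>

lemma exists_relevant_prime:
  assumes "homogeneous_ideal Q"
  shows "(\<exists>P. relevant_prime w P \<and> subset_upto w Q P) \<or> (\<exists>n. W n \<subseteq> Q n)"
  using wf_homogeneous_ideals[of w] assms
proof (induction Q rule: wf_induct_rule)
  case (less Q)
  show ?case
  proof (cases "W w \<subseteq> Q w \<or> relevant_prime w Q")
    case True
    then show ?thesis using subset_upto_refl by blast
  next
    case False
    show ?thesis
    proof (cases "\<exists>P. relevant_prime w P \<and> subset_upto w Q P")
      case none: False
      obtain n m a b where ab: "n + m \<le> w" "n \<le> w" "m \<le> w" "a \<in> W n" "b \<in> W m" "a \<otimes> b \<in> Q (n + m)"
        "a \<notin> Q n" "b \<notin> Q m"
        using homogeneous_ideal_split[OF less.prems] False by metis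
      have *: "\<exists>k. W k \<subseteq> adjoin Q l z k" if z: "z \<in> W l" "z \<notin> Q l" "l \<le> w" for z l
      proof -
        have "subset_upto w Q (adjoin Q l z)"
          using adjoin_subset[OF less.prems z(1)] by (simp add: subset_upto_def)
        then have "\<not> (\<exists>P. relevant_prime w P \<and> subset_upto w (adjoin Q l z) P)"
          using none subset_upto_trans by blast
        then show ?thesis
          using less.IH[OF adjoin_descent[OF less.prems z] adjoin_homogeneous_ideal[OF less.prems z(1)]]
          by blast
      qed
      obtain k where k: "W k \<subseteq> adjoin Q n a k" using *[OF ab(4,7,2)] by blast
      obtain l where l: "W l \<subseteq> adjoin Q m b l" using *[OF ab(5,8,3)] by blast
      note Qid = homogeneous_ideal_ideal[OF less.prems]
      have "W (k + l) \<subseteq> Q (k + l)"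
      proof (rule W_add_least[OF Qid])
        fix u v assume u: "u \<in> W k" and v: "v \<in> W l"
        have vad: "v \<in> adjoin Q m b l" using v l by blast
        from u k have "u \<in> adjoin Q n a k" by blast
        with less.prems show "u \<otimes> v \<in> Q (k + l)"
        proof (cases rule: adjoin_cases)
          case base
          then show ?thesis using homogeneous_ideal_mult'[OF less.prems _ v] by blast
        next
          case (step q c)
          note uq = this
          from less.prems vad show ?thesis
          proof (cases rule: adjoin_cases)
            case base
            then show ?thesis using homogeneous_ideal_mult[OF less.prems u] by blast
          next
            case (step q' c')
            have carr: "q \<in> carrier R" "q' \<in> carrier R" "a \<in> carrier R" "b \<in> carrier R"
              "c \<in> carrier R" "c' \<in> carrier R" "u \<in> carrier R" "v \<in> carrier R"
              using ideal.Icarr[OF Qid] uq(2) step(2) W_carr ab(4,5) uq(3) step(3) u v by blast+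
            have bc: "b \<otimes> c' \<in> W l" using W_mult[OF ab(5) step(3)] fun_add_diff_nat[OF step(1)] by simp
            have deg: "((k - n) + (l - m)) + (n + m) = k + l"
              using uq(1) step(1) by (auto simp: le_fun_def fun_eq_iff add_mono)
            have "(c \<otimes> c') \<otimes> (a \<otimes> b) \<in> Q (k + l)"
              using homogeneous_ideal_mult[OF less.prems W_mult[OF uq(3) step(3)] ab(6)] unfolding deg .
            moreover have "u \<otimes> q' \<in> Q (k + l)" using homogeneous_ideal_mult[OF less.prems u step(2)] .
            moreover have "q \<otimes> (b \<otimes> c') \<in> Q (k + l)"
              using homogeneous_ideal_mult'[OF less.prems uq(2) bc] .
            moreover have "u \<otimes> v = (u \<otimes> q' \<oplus> q \<otimes> (b \<otimes> c')) \<oplus> (c \<otimes> c') \<otimes> (a \<otimes> b)"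
            proof -
              have "u \<otimes> v = u \<otimes> q' \<oplus> u \<otimes> (b \<otimes> c')"
                unfolding step(4) using carr by (simp add: r_distr)
              also have "u \<otimes> (b \<otimes> c') = q \<otimes> (b \<otimes> c') \<oplus> (c \<otimes> c') \<otimes> (a \<otimes> b)"
                unfolding uq(4) using carr by algebra
              finally show ?thesis using carr by (simp add: a_assoc)
            qed
            ultimately show ?thesis using ideal_add[OF Qid] by metis
          qed
        qed
      qed
      then show ?thesis by blast
    qed simp
  qed
qed

text \<open>Graded analogue of \<open>minimal_primes\<close>: a relevant prime over \<open>Q\<close>
  contains one of the two factors of a product in \<open>Q\<close>, both of degree inside the
  window.\<close>

lemma minimal_relevant_primes:
  assumes "homogeneous_ideal Q"
  shows "\<exists>\<P>. finite \<P> \<and> (\<forall>P\<in>\<P>. relevant_prime w P) \<and>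
    (\<forall>P. relevant_prime w P \<longrightarrow> subset_upto w Q P \<longrightarrow>
      (\<exists>P0\<in>\<P>. subset_upto w Q P0 \<and> subset_upto w P0 P))"
  using wf_homogeneous_ideals[of w] assms
proof (induction Q rule: wf_induct_rule)
  case (less Q)
  consider "W w \<subseteq> Q w" | "relevant_prime w Q" | "\<not> W w \<subseteq> Q w" "\<not> relevant_prime w Q" by blast
  then show ?case
  proof cases
    case 1
    then have "\<not> subset_upto w Q P" if "relevant_prime w P" for P
      using that unfolding relevant_prime_def subset_upto_def by blast
    then show ?thesis by (intro exI[of _ "{}"]) auto
  next
    case 2
    then show ?thesis by (intro exI[of _ "{Q}"]) (auto simp: subset_upto_refl)
  next
    case 3
    obtain n m a b where ab: "n + m \<le> w" "n \<le> w" "m \<le> w" "a \<in> W n" "b \<in> W m" "a \<otimes> b \<in> Q (n + m)"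
      "a \<notin> Q n" "b \<notin> Q m"
      using homogeneous_ideal_split[OF less.prems 3] by metis
    have *: "subset_upto w Q (adjoin Q l z)" if "z \<in> W l" for z l
      using adjoin_subset[OF less.prems that] by (simp add: subset_upto_def)
    obtain \<A> where \<A>: "finite \<A>" "\<forall>P\<in>\<A>. relevant_prime w P"
      "\<forall>P. relevant_prime w P \<longrightarrow> subset_upto w (adjoin Q n a) P \<longrightarrow>
        (\<exists>P0\<in>\<A>. subset_upto w (adjoin Q n a) P0 \<and> subset_upto w P0 P)"
      using less.IH[OF adjoin_descent[OF less.prems ab(4,7,2)] adjoin_homogeneous_ideal[OF less.prems ab(4)]]
      by (elim exE conjE)
    obtain \<B> where \<B>: "finite \<B>" "\<forall>P\<in>\<B>. relevant_prime w P"
      "\<forall>P. relevant_prime w P \<longrightarrow> subset_upto w (adjoin Q m b) P \<longrightarrow>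
        (\<exists>P0\<in>\<B>. subset_upto w (adjoin Q m b) P0 \<and> subset_upto w P0 P)"
      using less.IH[OF adjoin_descent[OF less.prems ab(5,8,3)] adjoin_homogeneous_ideal[OF less.prems ab(5)]]
      by (elim exE conjE)
    show ?thesis
    proof (intro exI[of _ "\<A> \<union> \<B>"] conjI allI impI)
      fix P assume P: "relevant_prime w P" "subset_upto w Q P"
      have hP: "homogeneous_ideal P" using P(1) by (simp add: relevant_prime_def)
      have "a \<otimes> b \<in> P (n + m)" using P(2) ab(1,6) by (auto simp: subset_upto_def)
      then have "a \<in> P n \<or> b \<in> P m" using P(1) ab(1,4,5) by (auto simp: relevant_prime_def)
      then show "\<exists>P0\<in>\<A> \<union> \<B>. subset_upto w Q P0 \<and> subset_upto w P0 P"
      proof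
        assume "a \<in> P n"
        then obtain P0 where "P0 \<in> \<A>" "subset_upto w (adjoin Q n a) P0" "subset_upto w P0 P"
          using \<A>(3)[rule_format, OF P(1) adjoin_least[OF hP P(2)]] by blast
        then show ?thesis using subset_upto_trans[OF *[OF ab(4)]] by blast
      next
        assume "b \<in> P m"
        then obtain P0 where "P0 \<in> \<B>" "subset_upto w (adjoin Q m b) P0" "subset_upto w P0 P"
          using \<B>(3)[rule_format, OF P(1) adjoin_least[OF hP P(2)]] by blast
        then show ?thesis using subset_upto_trans[OF *[OF ab(5)]] by blast
      qed
    qed (use \<A> \<B> in auto)
  qed
qed

end

section \<open>Joint reductions of powers\<close>

context multigraded_ideals
begin

text \<open>One factor of growth per strict inclusion \<open>P0 \<subset> P\<close> witnessed by
  \<open>x\<close>. Since \<open>x\<close> is not in \<open>P0\<close>, multiplication by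
  \<open>x\<close> embeds \<open>W(n - e)/P0(n - e)\<close> into \<open>W(n)/P0(n)\<close>. Since
  \<open>x\<close> is in \<open>P\<close>, the image lies in \<open>P(n)\<close>, and above it there
  are still \<open>e\<close> steps from \<open>W(n)/P(n)\<close>. Iterating \<open>l\<close> times
  yields \<open>l * e\<close>.\<close>

lemma relevant_prime_chain_step:
  assumes P0: "relevant_prime w P0" and P: "relevant_prime w P" and sub: "subset_upto w P0 P"
    and x: "x \<in> W (unit_vec i)" "x \<in> P (unit_vec i)" "x \<notin> P0 (unit_vec i)"
    and growth: "\<And>n. n \<le> w \<Longrightarrow> (\<forall>j. k * m \<le> n j) \<Longrightarrow> ideal_chain R (W n) (P n) e"
    and "n \<le> w" "\<forall>j. k * m + l \<le> n j"
  shows "ideal_chain R (W n) (P0 n) (l * e)"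
  using assms(8,9)
proof (induction l arbitrary: n)
  case 0
  then show ?case using P0 homogeneous_ideal_subset by (auto simp: relevant_prime_def)
next
  case (Suc l)
  have hP: "homogeneous_ideal P" and hP0: "homogeneous_ideal P0"
    using P P0 by (auto simp: relevant_prime_def)
  let ?e = "unit_vec i"
  have le: "?e \<le> n" using Suc.prems(2) by (auto simp: unit_vec_le_iff intro: order_trans[rotated])
  have en: "?e + (n - ?e) = n" using fun_add_diff_nat[OF le] .
  have "n - ?e \<le> w"
    using Suc.prems(1) by (auto simp: le_fun_def intro: order_trans[OF diff_le_self])
  moreover have "\<forall>j. k * m + l \<le> (n - ?e) j"
  proof
    fix j show "k * m + l \<le> (n - ?e) j"
      using Suc.prems(2)[rule_format, of j] by (auto simp: unit_vec_def)
  qed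
  ultimately have IH: "ideal_chain R (W (n - ?e)) (P0 (n - ?e)) (l * e)" by (rule Suc.IH)
  have xc: "x \<in> carrier R" using W_carr[OF x(1)] .
  note id0 = homogeneous_ideal_ideal[OF hP0] and id = homogeneous_ideal_ideal[OF hP]
  have inj: "u \<in> P0 (n - ?e)" if u: "u \<in> W (n - ?e)" "x \<otimes> u \<in> P0 n" for u
  proof -
    have "x \<otimes> u \<in> P0 (?e + (n - ?e))" "?e + (n - ?e) \<le> w" using u(2) en Suc.prems(1) by simp_all
    then have "x \<in> P0 ?e \<or> u \<in> P0 (n - ?e)"
      using P0 x(1) u(1) unfolding relevant_prime_def by blast
    then show ?thesis using x(3) by blast
  qed
  have "ideal_chain R (P0 n <+> (x <# W (n - ?e))) (P0 n <+> (x <# P0 (n - ?e))) (l * e)"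
    using ideal_chain_image[OF xc W_ideal id0 inj id0 order_refl IH] by blast
  then have c1: "ideal_chain R (P0 n <+> (x <# W (n - ?e))) (P0 n) (l * e)"
    by (rule ideal_chain_antimono) (rule ideal_sum_left[OF id0 ideal_l_coset[OF id0 xc]])
  have "x <# W (n - ?e) \<subseteq> P n"
    using homogeneous_ideal_mult'[OF hP x(2)] en by (fastforce simp: l_coset_def)
  then have "P0 n <+> (x <# W (n - ?e)) \<subseteq> P n"
    using sub Suc.prems(1) by (intro ideal_sum_least[OF id]) (auto simp: subset_upto_def)
  then have c2: "ideal_chain R (W n) (P0 n <+> (x <# W (n - ?e))) e"
    using growth[OF Suc.prems(1)] Suc.prems(2) ideal_chain_antimono by (meson add_leD1)
  show ?case using ideal_chain_concat[OF c1 c2] by (simp add: add.commute)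
qed

text \<open>The element \<open>x b\<close> is taken in direction \<open>f b\<close>. The ideal
  \<open>Q'\<close> generated by \<open>Q\<close> and the chosen elements enters through its
  minimality in each degree. A relevant prime surviving all choices forces growth of order
  \<open>m ^ card B\<close> over some relevant prime above \<open>Q\<close>.\<close>

lemma exists_joint_reduction_upto:
  fixes B :: "'c set"
  assumes inf: "infinite (carrier (R Quot M))" and "finite B" and w: "\<forall>j. 1 \<le> w j"
    and "homogeneous_ideal Q"
  shows "\<exists>x Q'. (\<forall>b\<in>B. x b \<in> W (unit_vec (f b))) \<and> homogeneous_ideal Q' \<and>
    (\<forall>n A. ideal A R \<longrightarrow> Q n \<subseteq> A \<longrightarrow>
       (\<forall>b\<in>B. unit_vec (f b) \<le> n \<longrightarrow> x b <# W (n - unit_vec (f b)) \<subseteq> A) \<longrightarrow> Q' n \<subseteq> A) \<and>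
    (\<forall>P. relevant_prime w P \<longrightarrow> subset_upto w Q' P \<longrightarrow>
       (\<exists>P0. relevant_prime w P0 \<and> subset_upto w Q P0 \<and>
         (\<forall>m n. n \<le> w \<longrightarrow> (\<forall>j. card B * m \<le> n j) \<longrightarrow> ideal_chain R (W n) (P0 n) (m ^ card B))))"
  using assms(2,4)
proof (induction B arbitrary: Q rule: finite_induct)
  case empty
  show ?case
  proof (rule exI[of _ "\<lambda>_. undefined"], rule exI[of _ Q], intro conjI allI impI)
    fix P assume P: "relevant_prime w P" "subset_upto w Q P"
    \<comment> \<open>With no element chosen, \<open>W n\<close> properly contains
      \<open>P n\<close>, which is one step, as \<open>m ^ 0 = 1\<close>.\<close>
    have "ideal_chain R (W n) (P n) 1" if "n \<le> w" for n
      using relevant_prime_proper[OF P(1) that] homogeneous_ideal_subset[of P n] W_ideal[of n] P(1)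
      by (auto simp: relevant_prime_def)
    then show "\<exists>P0. relevant_prime w P0 \<and> subset_upto w Q P0 \<and>
         (\<forall>m n. n \<le> w \<longrightarrow> (\<forall>j. card ({} :: 'c set) * m \<le> n j) \<longrightarrow> ideal_chain R (W n) (P0 n) (m ^ card ({} :: 'c set)))"
      using P by (intro exI[of _ P]) auto
  qed (use empty in auto)
next
  case (insert c B)
  let ?e = "unit_vec (f c)"
  have ew: "?e \<le> w" using w by (simp add: unit_vec_le_iff)
  obtain \<P> where \<P>: "finite \<P>" "\<forall>P\<in>\<P>. relevant_prime w P"
    "\<forall>P. relevant_prime w P \<longrightarrow> subset_upto w Q P \<longrightarrow>
      (\<exists>P0\<in>\<P>. subset_upto w Q P0 \<and> subset_upto w P0 P)"
    using minimal_relevant_primes[OF insert.prems, of w] by (elim exE conjE)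
  \<comment> \<open>The degree of the new element lies in the window because
    \<open>w \<ge> 1\<close>, so every listed prime is proper there and avoidance applies to
    \<open>W ?e\<close>.\<close>
  have "\<not> W ?e \<subseteq> \<Union>((\<lambda>P. P ?e) ` \<P>)"
  proof
    assume "W ?e \<subseteq> \<Union>((\<lambda>P. P ?e) ` \<P>)"
    then have "\<exists>N\<in>(\<lambda>P. P ?e) ` \<P>. W ?e \<subseteq> N"
      using \<P>(1,2) by (intro ideal_avoidance[OF inf _ _ W_ideal])
        (auto simp: relevant_prime_def homogeneous_ideal_ideal)
    then show False using relevant_prime_proper[OF _ ew] \<P>(2) by auto
  qed
  then obtain y where y: "y \<in> W ?e" "\<forall>P\<in>\<P>. y \<notin> P ?e" by blast
  define Q1 where "Q1 = adjoin Q ?e y"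
  have Q1: "homogeneous_ideal Q1" unfolding Q1_def using adjoin_homogeneous_ideal[OF insert.prems y(1)] .
  obtain x Q' where xQ: "\<forall>b\<in>B. x b \<in> W (unit_vec (f b))" "homogeneous_ideal Q'"
    "\<forall>n A. ideal A R \<longrightarrow> Q1 n \<subseteq> A \<longrightarrow>
       (\<forall>b\<in>B. unit_vec (f b) \<le> n \<longrightarrow> x b <# W (n - unit_vec (f b)) \<subseteq> A) \<longrightarrow> Q' n \<subseteq> A"
    "\<forall>P. relevant_prime w P \<longrightarrow> subset_upto w Q' P \<longrightarrow>
       (\<exists>P0. relevant_prime w P0 \<and> subset_upto w Q1 P0 \<and>
         (\<forall>m n. n \<le> w \<longrightarrow> (\<forall>j. card B * m \<le> n j) \<longrightarrow> ideal_chain R (W n) (P0 n) (m ^ card B)))"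
    using insert.IH[OF Q1] by (elim exE conjE)
  let ?x = "x(c := y)"
  have xB: "?x b = x b" if "b \<in> B" for b using that insert.hyps by auto
  show ?case
  proof (rule exI[of _ ?x], rule exI[of _ Q'], intro conjI allI impI)
    show "\<forall>b\<in>insert c B. ?x b \<in> W (unit_vec (f b))" using y xQ(1) xB by auto
    show "homogeneous_ideal Q'" by fact
  next
    fix n A assume A: "ideal A R" "Q n \<subseteq> A"
      "\<forall>b\<in>insert c B. unit_vec (f b) \<le> n \<longrightarrow> ?x b <# W (n - unit_vec (f b)) \<subseteq> A"
    have "Q1 n \<subseteq> A"
      unfolding Q1_def adjoin_def using A ideal_zero[OF A(1)] by (intro ideal_sum_least) auto
    moreover have "\<forall>b\<in>B. unit_vec (f b) \<le> n \<longrightarrow> x b <# W (n - unit_vec (f b)) \<subseteq> A"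
      using A(3) xB by force
    ultimately show "Q' n \<subseteq> A" using xQ(3) A(1) by blast
  next
    fix P assume P: "relevant_prime w P" "subset_upto w Q' P"
    obtain P1 where P1: "relevant_prime w P1" "subset_upto w Q1 P1"
      and growth: "\<forall>m n. n \<le> w \<longrightarrow> (\<forall>j. card B * m \<le> n j) \<longrightarrow>
        ideal_chain R (W n) (P1 n) (m ^ card B)"
      using xQ(4)[rule_format, OF P] by (elim exE conjE)
    have "subset_upto w Q Q1"
      unfolding Q1_def subset_upto_def using adjoin_subset[OF insert.prems y(1)] by blast
    then obtain P0 where P0: "P0 \<in> \<P>" "subset_upto w Q P0" "subset_upto w P0 P1"
      using \<P>(3)[rule_format, OF P1(1)] P1(2) subset_upto_trans by blast
    have rP0: "relevant_prime w P0" using P0 \<P> by blast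
    have yP1: "y \<in> P1 ?e"
      using adjoin_self[OF insert.prems y(1)] P1(2) ew by (auto simp: Q1_def subset_upto_def)
    have "ideal_chain R (W n) (P0 n) (m ^ card (insert c B))"
      if n: "n \<le> w" "\<forall>j. card (insert c B) * m \<le> n j" for m n
    proof -
      \<comment> \<open>\<open>y\<close> is in \<open>P1\<close> but not in \<open>P0\<close>.
        Taking \<open>l = m\<close> in the chain step raises the exponent by one and the required
        degree from \<open>card B * m\<close> by another \<open>m\<close>.\<close>
      have "ideal_chain R (W n) (P0 n) (m * m ^ card B)"
        by (rule relevant_prime_chain_step[OF rP0 P1(1) P0(3) y(1) yP1, of "card B" m])
           (use y(2) P0(1) growth n insert.hyps in \<open>auto simp: add.commute\<close>)
      then show ?thesis using insert.hyps by simp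
    qed
    then show "\<exists>P0. relevant_prime w P0 \<and> subset_upto w Q P0 \<and>
         (\<forall>m n. n \<le> w \<longrightarrow> (\<forall>j. card (insert c B) * m \<le> n j) \<longrightarrow>
           ideal_chain R (W n) (P0 n) (m ^ card (insert c B)))"
      using rP0 P0(2) by blast
  qed
qed

section \<open>Powers of \<open>K\<close> along the diagonal\<close>

lemma W_const_Suc: "W (\<lambda>_. Suc N) = W (\<lambda>_. 1) \<cdot> W (\<lambda>_. N)"
proof -
  have "(\<lambda>_. Suc N) = (\<lambda>_. 1) + (\<lambda>_::'s. N)" by (simp add: fun_eq_iff)
  then show ?thesis using W_add by metis
qed

lemma W_const_pow:
  assumes "x \<in> W (\<lambda>_. 1)"
  shows "x [^] N \<in> W (\<lambda>_. N)"
proof (induction N)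
  case 0
  have "(\<lambda>_. 0) = (0 :: 's \<Rightarrow> nat)" by (simp add: fun_eq_iff)
  then show ?case using W_zero by simp
next
  case (Suc N)
  have "x [^] Suc N = x \<otimes> x [^] N" using W_carr[OF assms] by (simp add: m_comm)
  then show ?case unfolding W_const_Suc using ideal_prod.prod[OF assms Suc, of R] by simp
qed

lemma diagonal_chain:
  assumes "\<And>N. a \<le> N \<Longrightarrow> N < a + l \<Longrightarrow> ideal_chain R (W (\<lambda>_. N)) (W (\<lambda>_. Suc N)) e"
  shows "ideal_chain R (W (\<lambda>_. a)) (W (\<lambda>_. a + l)) (l * e)"
  using assms
proof (induction l)
  case (Suc l)
  have "ideal_chain R (W (\<lambda>_. a)) (W (\<lambda>_. a + l)) (l * e)" using Suc by simp
  moreover have "ideal_chain R (W (\<lambda>_. a + l)) (W (\<lambda>_. Suc (a + l))) e" using Suc.prems by simp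
  ultimately show ?case using ideal_chain_concat by fastforce
qed simp

text \<open>The equality of \<open>W n\<close> with the sum of the \<open>x b W(n - e)\<close> is
  tested against arbitrary ideals \<open>A\<close>; this form allows a colon ideal to be inserted
  for \<open>A\<close> later. \<open>B\<close> indexes the \<open>d\<close> elements and
  \<open>f\<close> gives their directions.\<close>

theorem joint_reduction_of_powers:
  assumes inf: "infinite (carrier (R Quot M))" and d: "krull_dim R = enat d" "1 \<le> d"
    and WM: "W (\<lambda>_. 1) \<subseteq> M" and prime: "\<forall>P. primeideal P R \<longrightarrow> W (\<lambda>_. 1) \<subseteq> P \<longrightarrow> P = M"
    and B: "finite B" "card B = d"
  obtains x n0 where "\<And>b. b \<in> B \<Longrightarrow> x b \<in> W (unit_vec (f b))"
    and "\<And>n A. n0 \<le> n \<Longrightarrow> ideal A R \<Longrightarrow>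
      (\<And>b. b \<in> B \<Longrightarrow> unit_vec (f b) \<le> n \<Longrightarrow> x b <# W (n - unit_vec (f b)) \<subseteq> A) \<Longrightarrow> W n \<subseteq> A"
proof -
  define K where "K = W (\<lambda>_. 1)"
  have K: "ideal K R" by (simp add: K_def W_ideal)
  obtain c where c: "\<And>N L. 1 \<le> N \<Longrightarrow> ideal L R \<Longrightarrow> (\<And>x. x \<in> K \<Longrightarrow> x [^] (N::nat) \<in> L) \<Longrightarrow>
      length_le R (carrier R) L (N ^ d * c)"
    using length_le_of_powers[OF inf K prime[folded K_def] d(1)] by metis
  \<comment> \<open>On the diagonal from \<open>d m\<close> to \<open>T = 2 d m\<close> there are
    \<open>d m\<close> steps of length at least \<open>m ^ d\<close>, against the bound
    \<open>T ^ d * c = (2 * d) ^ d * c * m ^ d\<close>. The value of \<open>m\<close> just exceeds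
    \<open>(2 * d) ^ d * c\<close>, so the bound fails.\<close>
  define m where "m = (2 * d) ^ d * c + 1"
  define T where "T = 2 * (d * m)"
  define w where "w = (\<lambda>_::'s. T)"
  have dm: "1 \<le> d * m" using d(2) by (simp add: m_def)
  then have T1: "1 \<le> T" by (simp add: T_def)
  have w1: "\<forall>j. 1 \<le> w j" using T1 by (simp add: w_def)
  \<comment> \<open>Starting from \<open>K W(n)\<close> amounts to working in the Rees algebra
    modulo \<open>K\<close>.\<close>
  define Q where "Q n = K \<cdot> W n" for n
  have Q: "homogeneous_ideal Q"
    unfolding homogeneous_ideal_def
  proof (intro conjI allI ballI)
    show idQ: "ideal (Q n) R" for n unfolding Q_def using ideal_prod_is_ideal[OF K W_ideal] .
    show "Q n \<subseteq> W n" for n unfolding Q_def using ideal_prod_inter[OF K W_ideal] by blast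
    fix n k a b assume a: "a \<in> W n" and b: "b \<in> Q k"
    \<comment> \<open>It suffices to check the products that generate \<open>Q k\<close>, since the
      right-hand side is a colon ideal.\<close>
    have "Q k \<subseteq> {r \<in> carrier R. r \<otimes> a \<in> Q (n + k)}"
      unfolding Q_def[of k]
    proof (rule ideal_prod_least[OF ideal_colon[OF idQ W_carr[OF a]]])
      fix u v assume u: "u \<in> K" and v: "v \<in> W k"
      have carr: "u \<in> carrier R" "v \<in> carrier R" "a \<in> carrier R"
        using ideal.Icarr[OF K u] W_carr v a by auto
      have "u \<otimes> (a \<otimes> v) \<in> Q (n + k)"
        unfolding Q_def using ideal_prod.prod[OF u W_mult[OF a v]] .
      moreover have "u \<otimes> v \<otimes> a = u \<otimes> (a \<otimes> v)" using carr by algebra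
      ultimately show "u \<otimes> v \<in> {r \<in> carrier R. r \<otimes> a \<in> Q (n + k)}" using carr by auto
    qed
    then have "b \<in> carrier R" "b \<otimes> a \<in> Q (n + k)" using b by auto
    then show "a \<otimes> b \<in> Q (n + k)" using m_comm W_carr[OF a] by simp
  qed
  obtain x Q' where x: "\<forall>b\<in>B. x b \<in> W (unit_vec (f b))" and Q': "homogeneous_ideal Q'"
    and least: "\<forall>n A. ideal A R \<longrightarrow> Q n \<subseteq> A \<longrightarrow>
       (\<forall>b\<in>B. unit_vec (f b) \<le> n \<longrightarrow> x b <# W (n - unit_vec (f b)) \<subseteq> A) \<longrightarrow> Q' n \<subseteq> A"
    and primes: "\<forall>P. relevant_prime w P \<longrightarrow> subset_upto w Q' P \<longrightarrow>
       (\<exists>P0. relevant_prime w P0 \<and> subset_upto w Q P0 \<and>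
         (\<forall>m n. n \<le> w \<longrightarrow> (\<forall>j. card B * m \<le> n j) \<longrightarrow> ideal_chain R (W n) (P0 n) (m ^ card B)))"
    using exists_joint_reduction_upto[OF inf B(1) w1 Q, of f] by (elim exE conjE)
  have "\<not> (\<exists>P. relevant_prime w P \<and> subset_upto w Q' P)"
  proof
    assume "\<exists>P. relevant_prime w P \<and> subset_upto w Q' P"
    then obtain P0 where P0: "subset_upto w Q P0"
      and growth: "\<And>m n. n \<le> w \<Longrightarrow> (\<forall>j. card B * m \<le> n j) \<Longrightarrow>
        ideal_chain R (W n) (P0 n) (m ^ card B)"
      using primes by blast
    have "ideal_chain R (W (\<lambda>_. N)) (W (\<lambda>_. Suc N)) (m ^ d)" if N: "d * m \<le> N" "N < d * m + d * m" for N
    proof (rule ideal_chain_antimono)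
      have Nw: "(\<lambda>_. N) \<le> w" using N by (simp add: w_def T_def le_fun_def)
      then show "ideal_chain R (W (\<lambda>_. N)) (P0 (\<lambda>_. N)) (m ^ d)" using growth N(1) B(2) by simp
      \<comment> \<open>\<open>K^(N+1)\<close> is \<open>Q\<close> in degree \<open>N\<close> on the
        diagonal, so a chain starting at \<open>P0\<close> also starts at \<open>K^(N+1)\<close>,
        and consecutive chains can be concatenated.\<close>
      show "W (\<lambda>_. Suc N) \<subseteq> P0 (\<lambda>_. N)"
        using P0 Nw unfolding W_const_Suc[of N] Q_def K_def subset_upto_def by blast
    qed
    then have "ideal_chain R (W (\<lambda>_. d * m)) (W (\<lambda>_. d * m + d * m)) (d * m * m ^ d)"
      by (rule diagonal_chain)
    then have "ideal_chain R (carrier R) (W (\<lambda>_. T)) (d * m * m ^ d)"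
      using ideal_chain_mono[OF _ ideal_subset[OF W_ideal]] unfolding T_def mult_2 by blast
    then have "d * m * m ^ d \<le> T ^ d * c"
      using c[OF T1 W_ideal W_const_pow] unfolding length_le_def K_def by blast
    also have "\<dots> = (2 * d) ^ d * c * m ^ d"
      by (simp add: T_def power_mult_distrib algebra_simps)
    finally have "d * m \<le> (2 * d) ^ d * c" by (simp add: m_def)
    moreover have "m \<le> d * m" using d(2) by simp
    ultimately show False by (simp add: m_def)
  qed
  then obtain n0 where n0: "W n0 \<subseteq> Q' n0" using exists_relevant_prime[OF Q', of w] by blast
  have "W n \<subseteq> A" if n: "n0 \<le> n" and A: "ideal A R"
    and xA: "\<And>b. b \<in> B \<Longrightarrow> unit_vec (f b) \<le> n \<Longrightarrow> x b <# W (n - unit_vec (f b)) \<subseteq> A" for n A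
  proof -
    have id: "ideal (A <+> Q n) R" using add_ideals[OF A homogeneous_ideal_ideal[OF Q]] .
    have sub: "A \<subseteq> A <+> Q n" "Q n \<subseteq> A <+> Q n"
      using ideal_sum_left ideal_sum_right A homogeneous_ideal_ideal[OF Q] by auto
    \<comment> \<open>Minimality of \<open>Q'\<close> gives \<open>W n \<subseteq> A + K W n\<close>
      in large degrees; Nakayama's lemma then drops the second summand.\<close>
    have "Q' n \<subseteq> A <+> Q n" using least id sub xA by blast
    then have "W n \<subseteq> A <+> K \<cdot> W n"
      using homogeneous_ideal_top_mono[OF Q' n0 n] by (auto simp: Q_def)
    then show ?thesis using nakayama[OF K _ W_ideal A] WM by (simp add: K_def)
  qed
  then show ?thesis using that[of x n0] x by blast
qed

end

section \<open>Sums and products of families of ideals\<close>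

context cring
begin

text \<open>For infinite \<open>S\<close> the sum defaults to \<open>\<zero>\<close>, which lies in
  every ideal.\<close>

lemma finsum_ideal_mem:
  assumes "ideal A R" "\<And>k. k \<in> S \<Longrightarrow> f k \<in> A"
  shows "finsum R f S \<in> A"
  using assms(2)
proof (induction S rule: infinite_finite_induct)
  case (insert k S)
  then have "f \<in> S \<rightarrow> carrier R" "f k \<in> carrier R" using ideal.Icarr[OF assms(1)] by auto
  then show ?case using insert ideal_add[OF assms(1)] by simp
qed (use ideal_zero[OF assms(1)] in simp_all)

text \<open>The finite sum in \<open>ideals_set R\<close> is the least upper bound of its summands;
  later arguments use it through these three facts.\<close>

lemma ideals_finsum:
  assumes "finite S" "\<And>i. i \<in> S \<Longrightarrow> ideal (f i) R"
  shows ideals_finsum_ideal: "ideal (\<Oplus>\<^bsub>ideals_set R\<^esub> i\<in>S. f i) R"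
    and ideals_finsum_upper: "i \<in> S \<Longrightarrow> f i \<subseteq> (\<Oplus>\<^bsub>ideals_set R\<^esub> i\<in>S. f i)"
    and ideals_finsum_least:
      "ideal L R \<Longrightarrow> (\<And>i. i \<in> S \<Longrightarrow> f i \<subseteq> L) \<Longrightarrow> (\<Oplus>\<^bsub>ideals_set R\<^esub> i\<in>S. f i) \<subseteq> L"
proof -
  interpret IS: semiring "ideals_set R" by (rule ideals_set_is_semiring)
  have sets: "carrier (ideals_set R) = {I. ideal I R}" "\<zero>\<^bsub>ideals_set R\<^esub> = {\<zero>}"
    "I \<oplus>\<^bsub>ideals_set R\<^esub> J = I <+> J" for I J by (simp_all add: ideals_set_def)
  have "ideal (\<Oplus>\<^bsub>ideals_set R\<^esub> i\<in>S. f i) R \<and> (\<forall>i\<in>S. f i \<subseteq> (\<Oplus>\<^bsub>ideals_set R\<^esub> i\<in>S. f i)) \<and>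
    (\<forall>L. ideal L R \<longrightarrow> (\<forall>i\<in>S. f i \<subseteq> L) \<longrightarrow> (\<Oplus>\<^bsub>ideals_set R\<^esub> i\<in>S. f i) \<subseteq> L)"
    using assms
  proof (induction S rule: finite_induct)
    case empty
    then show ?case using zeroideal ideal_zero by (simp add: sets)
  next
    case (insert k S)
    let ?s = "\<Oplus>\<^bsub>ideals_set R\<^esub> i\<in>S. f i"
    have eq: "(\<Oplus>\<^bsub>ideals_set R\<^esub> i\<in>insert k S. f i) = f k <+> ?s"
      using insert.hyps insert.prems by (subst IS.finsum_insert) (auto simp: sets)
    have k: "ideal (f k) R" and s: "ideal ?s R" using insert by auto
    show ?case
      unfolding eq using add_ideals[OF k s] ideal_sum_left[OF k s] ideal_sum_right[OF k s] insert
      by (intro conjI ballI allI impI ideal_sum_least) (auto 0 3)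
  qed
  then show "ideal (\<Oplus>\<^bsub>ideals_set R\<^esub> i\<in>S. f i) R"
    "i \<in> S \<Longrightarrow> f i \<subseteq> (\<Oplus>\<^bsub>ideals_set R\<^esub> i\<in>S. f i)"
    "ideal L R \<Longrightarrow> (\<And>i. i \<in> S \<Longrightarrow> f i \<subseteq> L) \<Longrightarrow> (\<Oplus>\<^bsub>ideals_set R\<^esub> i\<in>S. f i) \<subseteq> L"
    by auto
qed

lemma ideals_finprod_ideal:
  assumes "\<And>i. i \<in> S \<Longrightarrow> ideal (f i) R"
  shows "ideal (\<Otimes>\<^bsub>ideals_set R\<^esub> i\<in>S. f i) R"
proof -
  interpret IS: comm_monoid "ideals_set R" by (rule ideals_set_is_comm_monoid)
  have "(\<Otimes>\<^bsub>ideals_set R\<^esub> i\<in>S. f i) \<in> carrier (ideals_set R)"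
    using assms by (intro IS.finprod_closed) (auto simp: ideals_set_def)
  then show ?thesis by (simp add: ideals_set_def)
qed

lemma ideals_finprod_single:
  fixes f :: "'s::finite \<Rightarrow> 'a set"
  assumes "ideal (f i) R" "\<And>k. k \<noteq> i \<Longrightarrow> f k = carrier R"
  shows "(\<Otimes>\<^bsub>ideals_set R\<^esub> k\<in>UNIV. f k) = f i"
proof -
  interpret IS: comm_monoid "ideals_set R" by (rule ideals_set_is_comm_monoid)
  have "f = (\<lambda>k. if i = k then f k else \<one>\<^bsub>ideals_set R\<^esub>)"
    by (rule ext) (simp add: assms(2) ideals_set_def)
  then have "(\<Otimes>\<^bsub>ideals_set R\<^esub> k\<in>UNIV. f k) =
      (\<Otimes>\<^bsub>ideals_set R\<^esub> k\<in>UNIV. if i = k then f k else \<one>\<^bsub>ideals_set R\<^esub>)"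
    by simp
  also have "\<dots> = f i"
  proof (rule IS.finprod_singleton)
    have "ideal (f k) R" for k using assms oneideal by (cases "k = i") auto
    then show "f \<in> UNIV \<rightarrow> carrier (ideals_set R)" by (auto simp: ideals_set_def)
  qed auto
  finally show ?thesis .
qed

section \<open>Multigraded powers \<open>J(n)\<close>\<close>

lemma ideals_pow_ideal:
  assumes "ideal I R"
  shows "ideal (I [^]\<^bsub>ideals_set R\<^esub> (n::nat)) R"
proof -
  interpret IS: comm_monoid "ideals_set R" by (rule ideals_set_is_comm_monoid)
  show ?thesis using IS.nat_pow_closed[of I n] assms by (simp add: ideals_set_def)
qed

text \<open>Truncation by \<open>nat\<close> is additive on nonnegative vectors, and the power law
  applies in each factor. For mixed signs equality can fail and an inclusion is left.\<close>

lemma mpow_add: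
  fixes J :: "'s::finite \<Rightarrow> 'a set"
  assumes J: "\<And>i. ideal (J i) R" and "0 \<le> n" "0 \<le> m"
  shows "mpow R J (n + m) = mpow R J n \<cdot> mpow R J m"
proof -
  interpret IS: comm_monoid "ideals_set R" by (rule ideals_set_is_comm_monoid)
  have c: "J i \<in> carrier (ideals_set R)" for i using J by (simp add: ideals_set_def)
  have "nat ((n + m) i) = nat (n i) + nat (m i)" for i
    using assms(2,3) by (simp add: le_fun_def nat_add_distrib)
  then have "mpow R J (n + m) = mpow R J n \<otimes>\<^bsub>ideals_set R\<^esub> mpow R J m"
    unfolding mpow_def using c by (simp add: IS.nat_pow_mult[symmetric] flip: IS.finprod_multf)
  then show ?thesis by (simp add: ideals_set_def)
qed

lemma mpow_nonpos:
  fixes J :: "'s::finite \<Rightarrow> 'a set"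
  assumes "n \<le> 0"
  shows "mpow R J n = carrier R"
proof -
  interpret IS: comm_monoid "ideals_set R" by (rule ideals_set_is_comm_monoid)
  have "mpow R J n = \<one>\<^bsub>ideals_set R\<^esub>"
    unfolding mpow_def using assms by (intro IS.finprod_one_eqI) (simp add: le_fun_def)
  then show ?thesis by (simp add: ideals_set_def)
qed

lemma mpow_ideal:
  fixes J :: "'s::finite \<Rightarrow> 'a set"
  assumes "\<And>i. ideal (J i) R"
  shows "ideal (mpow R J n) R"
  unfolding mpow_def by (intro ideals_finprod_ideal ideals_pow_ideal assms)

lemma mpow_evec:
  fixes J :: "'s::finite \<Rightarrow> 'a set"
  assumes J: "\<And>i. ideal (J i) R"
  shows "mpow R J (evec i 1) = J i"
proof -
  interpret IS: comm_monoid "ideals_set R" by (rule ideals_set_is_comm_monoid)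
  have c: "J i \<in> carrier (ideals_set R)" using J by (simp add: ideals_set_def)
  have 1: "J i [^]\<^bsub>ideals_set R\<^esub> (1::nat) = J i" using IS.nat_pow_eone[OF c] by simp
  have "mpow R J (evec i 1) = J i [^]\<^bsub>ideals_set R\<^esub> nat (evec i 1 i)"
    unfolding mpow_def
  proof (rule ideals_finprod_single)
    show "J k [^]\<^bsub>ideals_set R\<^esub> nat (evec i 1 k) = carrier R" if "k \<noteq> i" for k
      using that by (simp add: evec_def) (simp add: ideals_set_def)
  qed (rule ideals_pow_ideal[OF J])
  then show ?thesis using 1 by (simp add: evec_def)
qed

lemma mpow_nat: "mpow R J (\<lambda>i. int (nat (n i))) = mpow R J n"
  unfolding mpow_def by (simp only: nat_int)

end

section \<open>Laurent polynomials\<close>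

lemma laurent_ring_sel:
  "carrier (laurent_ring R) = {f. (\<forall>n. f n \<in> carrier R) \<and> finite {n. f n \<noteq> \<zero>\<^bsub>R\<^esub>}}"
  "f \<otimes>\<^bsub>laurent_ring R\<^esub> g = (\<lambda>n. \<Oplus>\<^bsub>R\<^esub> k \<in> {k. f k \<noteq> \<zero>\<^bsub>R\<^esub>}. f k \<otimes>\<^bsub>R\<^esub> g (n - k))"
  "\<one>\<^bsub>laurent_ring R\<^esub> = (\<lambda>n. if n = 0 then \<one>\<^bsub>R\<^esub> else \<zero>\<^bsub>R\<^esub>)"
  "\<zero>\<^bsub>laurent_ring R\<^esub> = (\<lambda>n. \<zero>\<^bsub>R\<^esub>)"
  "f \<oplus>\<^bsub>laurent_ring R\<^esub> g = (\<lambda>n. f n \<oplus>\<^bsub>R\<^esub> g n)"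
  by (simp_all add: laurent_ring_def)

context cring
begin

lemma lmonom_carrier: "a \<in> carrier R \<Longrightarrow> lmonom R a n \<in> carrier (laurent_ring R)"
  by (auto simp: laurent_ring_sel lmonom_def)

lemma laurent_add_closed:
  assumes "f \<in> carrier (laurent_ring R)" "g \<in> carrier (laurent_ring R)"
  shows "f \<oplus>\<^bsub>laurent_ring R\<^esub> g \<in> carrier (laurent_ring R)"
proof -
  have "{n. f n \<oplus> g n \<noteq> \<zero>} \<subseteq> {n. f n \<noteq> \<zero>} \<union> {n. g n \<noteq> \<zero>}" by auto
  then show ?thesis using assms by (auto simp: laurent_ring_sel elim: finite_subset)
qed

lemma laurent_uminus_closed:
  assumes "f \<in> carrier (laurent_ring R)"
  shows "(\<lambda>n. \<ominus> f n) \<in> carrier (laurent_ring R)"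
proof -
  have "{n. \<ominus> f n \<noteq> \<zero>} \<subseteq> {n. f n \<noteq> \<zero>}" by auto
  then show ?thesis using assms by (auto simp: laurent_ring_sel elim: finite_subset)
qed

lemma laurent_abelian_group:
  "abelian_group (laurent_ring R :: (('s::finite \<Rightarrow> int) \<Rightarrow> 'a) ring)"
proof (rule abelian_groupI)
  fix f g h :: "('s \<Rightarrow> int) \<Rightarrow> 'a"
  assume f: "f \<in> carrier (laurent_ring R)"
  then show "\<zero>\<^bsub>laurent_ring R\<^esub> \<oplus>\<^bsub>laurent_ring R\<^esub> f = f"
    by (simp add: laurent_ring_sel)
  show "\<exists>g\<in>carrier (laurent_ring R). g \<oplus>\<^bsub>laurent_ring R\<^esub> f = \<zero>\<^bsub>laurent_ring R\<^esub>"
    using laurent_uminus_closed[OF f] f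
    by (intro bexI[of _ "\<lambda>n. \<ominus> f n"]) (auto simp: laurent_ring_sel l_neg)
  assume g: "g \<in> carrier (laurent_ring R)"
  then show "f \<oplus>\<^bsub>laurent_ring R\<^esub> g = g \<oplus>\<^bsub>laurent_ring R\<^esub> f"
    using f by (auto simp: laurent_ring_sel a_comm)
  assume h: "h \<in> carrier (laurent_ring R)"
  show "f \<oplus>\<^bsub>laurent_ring R\<^esub> g \<oplus>\<^bsub>laurent_ring R\<^esub> h = f \<oplus>\<^bsub>laurent_ring R\<^esub> (g \<oplus>\<^bsub>laurent_ring R\<^esub> h)"
    using f g h by (auto simp: laurent_ring_sel a_assoc)
qed (simp_all add: laurent_add_closed, simp add: laurent_ring_sel)

lemma laurent_uminus:
  fixes f :: "('s::finite \<Rightarrow> int) \<Rightarrow> 'a"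
  assumes "f \<in> carrier (laurent_ring R)"
  shows "\<ominus>\<^bsub>laurent_ring R\<^esub> f = (\<lambda>n. \<ominus> f n)"
proof -
  interpret L: abelian_group "laurent_ring R :: (('s \<Rightarrow> int) \<Rightarrow> 'a) ring"
    by (rule laurent_abelian_group)
  show ?thesis
  proof (rule L.minus_equality)
    show "(\<lambda>n. \<ominus> f n) \<oplus>\<^bsub>laurent_ring R\<^esub> f = \<zero>\<^bsub>laurent_ring R\<^esub>"
      using assms by (auto simp: laurent_ring_sel l_neg)
  qed (use assms laurent_uminus_closed in auto)
qed

lemma laurent_mult_apply_mem:
  fixes f g :: "('s::finite \<Rightarrow> int) \<Rightarrow> 'a"
  assumes "ideal A R" "\<And>k. f k \<otimes> g (n - k) \<in> A"
  shows "(f \<otimes>\<^bsub>laurent_ring R\<^esub> g) n \<in> A"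
  unfolding laurent_ring_sel by (rule finsum_ideal_mem[OF assms(1)]) (rule assms(2))

text \<open>The support of the product lies in the sumset of the two finite supports.\<close>

lemma laurent_mult_closed:
  fixes f g :: "('s::finite \<Rightarrow> int) \<Rightarrow> 'a"
  assumes f: "f \<in> carrier (laurent_ring R)" and g: "g \<in> carrier (laurent_ring R)"
  shows "f \<otimes>\<^bsub>laurent_ring R\<^esub> g \<in> carrier (laurent_ring R)"
proof -
  have fg: "f n \<in> carrier R" "g n \<in> carrier R" for n using f g by (auto simp: laurent_ring_sel)
  have zero: "(f \<otimes>\<^bsub>laurent_ring R\<^esub> g) n = \<zero>"
    if n: "n \<notin> (\<lambda>(k, l). k + l) ` ({k. f k \<noteq> \<zero>} \<times> {l. g l \<noteq> \<zero>})" for n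
  proof -
    have "f k \<otimes> g (n - k) \<in> {\<zero>}" for k
    proof (rule ccontr)
      assume "f k \<otimes> g (n - k) \<notin> {\<zero>}"
      then have "f k \<noteq> \<zero>" "g (n - k) \<noteq> \<zero>" using fg by auto
      moreover have "n = k + (n - k)" by simp
      ultimately show False using n by (force simp: image_iff)
    qed
    then show ?thesis using laurent_mult_apply_mem[OF zeroideal] by blast
  qed
  have "finite ((\<lambda>(k, l). k + l) ` ({k. f k \<noteq> \<zero>} \<times> {l. g l \<noteq> \<zero>}))"
    using f g by (auto simp: laurent_ring_sel)
  then have "finite {n. (f \<otimes>\<^bsub>laurent_ring R\<^esub> g) n \<noteq> \<zero>}"
    by (rule rev_finite_subset) (use zero in blast)
  moreover have "(f \<otimes>\<^bsub>laurent_ring R\<^esub> g) n \<in> carrier R" for n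
    by (rule laurent_mult_apply_mem[OF oneideal]) (use fg in simp)
  ultimately show ?thesis by (subst laurent_ring_sel(1)) simp
qed

lemma laurent_finsum_apply:
  fixes h :: "'g \<Rightarrow> ('s::finite \<Rightarrow> int) \<Rightarrow> 'a"
  assumes "finite G" "h \<in> G \<rightarrow> carrier (laurent_ring R)"
  shows "(\<Oplus>\<^bsub>laurent_ring R\<^esub> g\<in>G. h g) n = (\<Oplus>g\<in>G. h g n)"
proof -
  interpret L: abelian_group "laurent_ring R :: (('s \<Rightarrow> int) \<Rightarrow> 'a) ring"
    by (rule laurent_abelian_group)
  show ?thesis
    using assms
  proof (induction G rule: finite_induct)
    case empty
    then show ?case by (simp add: laurent_ring_sel)
  next
    case (insert g G)
    then have h: "(\<lambda>g. h g n) \<in> G \<rightarrow> carrier R" "h g n \<in> carrier R"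
      by (auto simp: laurent_ring_sel Pi_iff)
    have "(\<Oplus>\<^bsub>laurent_ring R\<^esub> g\<in>insert g G. h g) = h g \<oplus>\<^bsub>laurent_ring R\<^esub> (\<Oplus>\<^bsub>laurent_ring R\<^esub> g\<in>G. h g)"
      using insert by (intro L.finsum_insert) auto
    then show ?case using insert h by (simp add: laurent_ring_sel(5))
  qed
qed

text \<open>The generators of the extended Rees algebra are monomials with coefficients in the
  matching \<open>J(n)\<close>, with \<open>J(n) = R\<close> for \<open>n \<le> 0\<close>, and the
  condition on coefficients survives the ring operations.\<close>

lemma ext_rees_coeff:
  fixes J :: "'s::finite \<Rightarrow> 'a set"
  assumes J: "\<And>i. ideal (J i) R"
    and mult: "\<And>k l a b. a \<in> mpow R J k \<Longrightarrow> b \<in> mpow R J l \<Longrightarrow> a \<otimes> b \<in> mpow R J (k + l)"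
    and "c \<in> ext_rees R J"
  shows "c \<in> carrier (laurent_ring R) \<and> (\<forall>k. c k \<in> mpow R J k)"
  using assms(3) unfolding ext_rees_def
proof (induction rule: generate_ring.induct)
  case one
  have "lmonom R \<one> 0 \<in> carrier (laurent_ring R)" by (rule lmonom_carrier) simp
  then show ?case
    using mpow_nonpos[of 0 J] ideal_zero[OF mpow_ideal[of J, OF J]] by (auto simp: laurent_ring_sel lmonom_def)
next
  case (incl h)
  have *: "lmonom R a n \<in> carrier (laurent_ring R) \<and> (\<forall>k. lmonom R a n k \<in> mpow R J k)"
    if "a \<in> mpow R J n" for a n
    using lmonom_carrier[OF ideal.Icarr[OF mpow_ideal[of J, OF J] that]] ideal_zero[OF mpow_ideal[of J, OF J]] that
    by (auto simp: lmonom_def)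
  have "mpow R J 0 = carrier R" "mpow R J (evec i (-1)) = carrier R" for i
    by (rule mpow_nonpos; simp add: evec_def le_fun_def)+
  moreover have "mpow R J (evec i 1) = J i" for i using mpow_evec[of J, OF J] .
  ultimately have "\<exists>a n. h = lmonom R a n \<and> a \<in> mpow R J n"
    using incl by (elim UnE CollectE exE conjE) (metis one_closed)+
  then show ?case using * by blast
next
  case (a_inv h)
  then show ?case
    using laurent_uminus_closed[of h] additive_subgroup.a_inv_closed[OF ideal.axioms(1)[OF mpow_ideal[of J, OF J]]]
    by (simp add: laurent_uminus)
next
  case (eng_add h1 h2)
  then show ?case
    using laurent_add_closed[of h1 h2] ideal_add[OF mpow_ideal[of J, OF J]] by (simp add: laurent_ring_sel(5))
next
  case (eng_mult h1 h2)
  have "(h1 \<otimes>\<^bsub>laurent_ring R\<^esub> h2) n \<in> mpow R J n" for n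
    by (rule laurent_mult_apply_mem[OF mpow_ideal[of J, OF J]])
       (use eng_mult mult[of "h1 k" k "h2 (n - k)" "n - k" for k] in simp)
  then show ?case using laurent_mult_closed eng_mult by blast
qed

end

section \<open>Admissible families\<close>

lemma m_primaryD:
  assumes "m_primary R M Q"
  shows m_primary_ideal: "ideal Q R"
    and m_primary_pow: "a \<in> M \<Longrightarrow> \<exists>n::nat. a [^]\<^bsub>R\<^esub> n \<in> Q"
  using assms by (auto simp: m_primary_def primary_ideal_def radical_def)

lemma primeideal_pow_mem:
  fixes R (structure)
  assumes "primeideal P R" "a \<in> carrier R" "a [^] (n::nat) \<in> P"
  shows "a \<in> P"
proof -
  interpret primeideal P R by fact
  show ?thesis
    using assms(3)
  proof (induction n)
    case 0
    then show ?case using one_imp_carrier I_notcarr by simp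
  next
    case (Suc n)
    then show ?case using I_prime[of "a [^] n" a] assms(2) by auto
  qed
qed

context noetherian_local_ring
begin

lemma m_primary_subset: "m_primary R M Q \<Longrightarrow> Q \<subseteq> M"
  using proper_ideal_subset_M by (simp add: m_primary_def primary_ideal_def)

lemma mpow_multigraded_ideals:
  fixes J :: "'s::finite \<Rightarrow> 'a set"
  assumes "\<And>i. ideal (J i) R"
  shows "multigraded_ideals R M (\<lambda>n. mpow R J (\<lambda>i. int (n i)))"
proof (intro multigraded_ideals.intro multigraded_ideals_axioms.intro noetherian_local_ring_axioms)
  fix n m :: "'s \<Rightarrow> nat"
  show "ideal (mpow R J (\<lambda>i. int (n i))) R" by (rule mpow_ideal[OF assms])
  show "mpow R J (\<lambda>i. int ((0 :: 's \<Rightarrow> nat) i)) = carrier R"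
    by (rule mpow_nonpos) (simp add: le_fun_def)
  have "(\<lambda>i. int ((n + m) i)) = (\<lambda>i. int (n i)) + (\<lambda>i. int (m i))"
    by (simp add: fun_eq_iff)
  then show "mpow R J (\<lambda>i. int ((n + m) i)) = mpow R J (\<lambda>i. int (n i)) \<cdot> mpow R J (\<lambda>i. int (m i))"
    using mpow_add[OF assms, of "\<lambda>i. int (n i)" "\<lambda>i. int (m i)"] by (simp add: le_fun_def)
qed

text \<open>Transfers the result for powers to integer multidegrees, after showing that
  \<open>M\<close> is the only prime over \<open>J_1 ... J_s\<close>.\<close>

lemma exists_joint_reduction:
  fixes J :: "'s::finite \<Rightarrow> 'a set" and f :: "'c \<Rightarrow> 's"
  assumes inf: "infinite (carrier (R Quot M))" and d: "krull_dim R = enat d" "1 \<le> d"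
    and J: "\<And>i. m_primary R M (J i)" and B: "finite B" "card B = d"
  shows "\<exists>x n0. (\<forall>b\<in>B. x b \<in> J (f b)) \<and>
    (\<forall>n A. (\<forall>i. int (n0 i) \<le> n i) \<longrightarrow> ideal A R \<longrightarrow>
      (\<forall>b\<in>B. \<forall>u\<in>mpow R J (n - evec (f b) 1). x b \<otimes> u \<in> A) \<longrightarrow> mpow R J n \<subseteq> A)"
proof -
  define W where "W n = mpow R J (\<lambda>i. int (n i))" for n :: "'s \<Rightarrow> nat"
  have Jid: "\<And>i. ideal (J i) R" using m_primary_ideal[OF J] .
  interpret multigraded_ideals R M W
    using mpow_multigraded_ideals[of J, OF Jid] unfolding W_def[abs_def] .
  have unit: "W (unit_vec i) = J i" for i
  proof -
    have "(\<lambda>k. int (unit_vec i k)) = evec i 1" by (auto simp: unit_vec_def evec_def)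
    then show ?thesis using mpow_evec[of J, OF Jid] by (simp add: W_def)
  qed
  \<comment> \<open>Types are inhabited, so at least one factor \<open>J_i\<close> exists and bounds
    the product inside \<open>M\<close>.\<close>
  obtain i0 :: 's where True by simp
  have "W (\<lambda>_. 1) \<subseteq> W (unit_vec i0)" by (rule W_antimono) (simp add: unit_vec_le_iff)
  then have WM: "W (\<lambda>_. 1) \<subseteq> M" using m_primary_subset[OF J] unit by blast
  \<comment> \<open>Adding one factor at a time: if powers of \<open>a\<close> lie in two ideals,
    their product lies in the product ideal.\<close>
  have pow: "\<exists>N::nat. a [^] N \<in> W (\<lambda>k. if k \<in> S then 1 else 0)" if a: "a \<in> M" for a and S :: "'s set"
    using finite[of S]
  proof (induction S rule: finite_induct)
    case empty
    have "(\<lambda>k. 0) = (0 :: 's \<Rightarrow> nat)" by (simp add: fun_eq_iff)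
    then have "a [^] (0::nat) \<in> W (\<lambda>k. if k \<in> {} then 1 else 0)" using W_zero by simp
    then show ?case by blast
  next
    case (insert i S)
    have ac: "a \<in> carrier R" using ideal.Icarr[OF M_ideal a] .
    obtain N where N: "a [^] (N::nat) \<in> W (\<lambda>k. if k \<in> S then 1 else 0)" using insert.IH by blast
    obtain l where l: "a [^] (l::nat) \<in> W (unit_vec i)" using m_primary_pow[OF J a] unit by blast
    have eq: "unit_vec i + (\<lambda>k. if k \<in> S then 1 else 0) = (\<lambda>k. if k \<in> insert i S then 1 else 0)"
      using insert.hyps by (auto simp: unit_vec_def fun_eq_iff)
    have "a [^] (l + N) \<in> W (\<lambda>k. if k \<in> insert i S then 1 else 0)"
      using W_mult[OF l N] ac unfolding eq by (simp add: nat_pow_mult)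
    then show ?case by blast
  qed
  have prime: "\<forall>P. primeideal P R \<longrightarrow> W (\<lambda>_. 1) \<subseteq> P \<longrightarrow> P = M"
  proof (intro allI impI)
    fix P assume P: "primeideal P R" "W (\<lambda>_. 1) \<subseteq> P"
    have "a \<in> P" if a: "a \<in> M" for a
    proof -
      obtain N where "a [^] (N::nat) \<in> W (\<lambda>_. 1)" using pow[OF a, of UNIV] by auto
      then show ?thesis using primeideal_pow_mem[OF P(1) ideal.Icarr[OF M_ideal a]] P(2) by blast
    qed
    then show "P = M" using prime_subset_M[OF P(1)] by blast
  qed
  obtain x n0 where x: "\<And>b. b \<in> B \<Longrightarrow> x b \<in> W (unit_vec (f b))"
    and red: "\<And>n A. n0 \<le> n \<Longrightarrow> ideal A R \<Longrightarrow>
      (\<And>b. b \<in> B \<Longrightarrow> unit_vec (f b) \<le> n \<Longrightarrow> x b <# W (n - unit_vec (f b)) \<subseteq> A) \<Longrightarrow> W n \<subseteq> A"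
    using joint_reduction_of_powers[OF inf d WM prime B, of f] by metis
  have "mpow R J n \<subseteq> A" if n: "\<forall>i. int (n0 i) \<le> n i" and A: "ideal A R"
    and xA: "\<forall>b\<in>B. \<forall>u\<in>mpow R J (n - evec (f b) 1). x b \<otimes> u \<in> A" for n A
  proof -
    let ?n = "\<lambda>i. nat (n i)"
    have n_eq: "n = (\<lambda>i. int (?n i))"
      using order_trans[OF of_nat_0_le_iff n[rule_format]] by (simp add: fun_eq_iff)
    have "W ?n \<subseteq> A"
    proof (rule red[OF _ A])
      show "n0 \<le> ?n"
      proof (rule le_funI)
        show "n0 i \<le> ?n i" for i using n[rule_format, of i] by linarith
      qed
      fix b assume b: "b \<in> B" "unit_vec (f b) \<le> ?n"
      \<comment> \<open>The truncated difference agrees with the integer one because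
        \<open>unit_vec (f b)\<close> is below \<open>?n\<close>.\<close>
      have "(\<lambda>i. int ((?n - unit_vec (f b)) i)) = n - evec (f b) 1"
        using b(2) unfolding unit_vec_le_iff
        by (subst (2) n_eq) (auto simp: fun_eq_iff unit_vec_def evec_def of_nat_diff)
      then show "x b <# W (?n - unit_vec (f b)) \<subseteq> A"
        using xA b(1) by (auto simp: W_def l_coset_def)
    qed
    then show ?thesis using n_eq by (simp add: W_def)
  qed
  then show ?thesis using x unit by (intro exI[of _ x] exI[of _ n0]) auto
qed

end

section \<open>Transfer from the powers \<open>J(n)\<close> to the filtration
  \<open>F(n)\<close>\<close>

theorem theorem4p6:
  fixes R :: "('a, 'b) ring_scheme" and M :: "'a set" and d :: nat
    and I :: "'s::finite \<Rightarrow> nat \<Rightarrow> 'a set" and J :: "'s \<Rightarrow> 'a set" and r :: "'s \<Rightarrow> nat"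
  assumes "noetherian_local_ring R M"
    and "krull_dim R = enat d" and "d \<ge> 1"
    and "\<And>i. graded_m_primary_family R M (I i)"
    and "infinite (carrier (R Quot M))"
    and "multigraded_admissible R M I J"
    and "(\<Sum>i\<in>UNIV. r i) = d"
  shows "\<exists>x :: 's \<Rightarrow> nat \<Rightarrow> 'a.
    (\<forall>i. J i \<subseteq> I i 1 \<and> (\<forall>j\<in>{1..r i}. x i j \<in> J i)) \<and>
    for_large (\<lambda>n. mfilt R I n =
      (\<Oplus>\<^bsub>ideals_set R\<^esub> i \<in> UNIV. \<Oplus>\<^bsub>ideals_set R\<^esub> j \<in> {1..r i}.
         x i j <#\<^bsub>R\<^esub> mfilt R I (n - evec i 1))) \<and>
    degree_one_strong_homogeneous_joint_reduction R I r x"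
proof -
  interpret noetherian_local_ring R M by fact
  let ?L = "laurent_ring R :: (('s \<Rightarrow> int) \<Rightarrow> 'a) ring" and ?F = "mfilt R I"
  have J: "m_primary R M (J i)" for i
    using assms(6) by (simp add: multigraded_admissible_def)
  have JF: "mpow R J n \<subseteq> ?F n" for n
    using assms(6) by (simp add: multigraded_admissible_def)
  have FF: "a \<otimes>\<^bsub>R\<^esub> b \<in> ?F (n + m)" if "a \<in> ?F n" "b \<in> ?F m" for a b n m
    using assms(6) ideal_prod.prod[OF that, of R] unfolding multigraded_admissible_def by blast
  have "finite_module_over ?L (ext_rees R J) (rees_sum R ?F)"
    using assms(6) by (simp add: multigraded_admissible_def)
  then obtain G where G: "finite G" "G \<subseteq> rees_sum R ?F"
    "rees_sum R ?F = {\<Oplus>\<^bsub>?L\<^esub> g \<in> G. c g \<otimes>\<^bsub>?L\<^esub> g | c. c \<in> G \<rightarrow> ext_rees R J}"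
    unfolding finite_module_over_def by (elim exE conjE)
  have Iid: "ideal (I i n) R" and I0: "I i 0 = carrier R" for i n
    using assms(4) by (auto simp: graded_m_primary_family_def)
  have Fid: "ideal (?F n) R" for n
    unfolding mfilt_def by (intro ideals_finprod_ideal Iid)
  have Jid: "\<And>i. ideal (J i) R" using m_primary_ideal[OF J] .
  have F_evec: "?F (evec i 1) = I i 1" for i
  proof -
    have "?F (evec i 1) = I i (nat (evec i 1 i))"
      unfolding mfilt_def by (rule ideals_finprod_single) (auto simp: Iid I0 evec_def)
    then show ?thesis by (simp add: evec_def)
  qed
  have JI: "J i \<subseteq> I i 1" for i
    using JF[of "evec i 1"] mpow_evec[of J, OF Jid] F_evec by simp
  have Jmult: "a \<otimes>\<^bsub>R\<^esub> b \<in> mpow R J (k + l)" if "a \<in> mpow R J k" "b \<in> mpow R J l" for a b k l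
  proof -
    define W where "W n = mpow R J (\<lambda>i. int (n i))" for n :: "'s \<Rightarrow> nat"
    interpret multigraded_ideals R M W
      using mpow_multigraded_ideals[of J, OF Jid] unfolding W_def[abs_def] .
    have W: "W (\<lambda>i. nat (n i)) = mpow R J n" for n by (simp only: W_def mpow_nat)
    \<comment> \<open>Truncation is subadditive, and \<open>J(n)\<close> decreases as
      \<open>n\<close> grows; this covers negative exponents.\<close>
    have "(\<lambda>i. nat ((k + l) i)) \<le> (\<lambda>i. nat (k i)) + (\<lambda>i. nat (l i))"
      by (auto simp: le_fun_def)
    then show ?thesis
      using W_antimono W_mult[of a "\<lambda>i. nat (k i)" b "\<lambda>i. nat (l i)"] that W by blast
  qed
  define B where "B = (SIGMA i:(UNIV :: 's set). {1..r i})"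
  have B: "finite B" "card B = d" using assms(7) by (auto simp: B_def card_SigmaI)
  obtain x n0 where x: "\<forall>b\<in>B. x b \<in> J (fst b)"
    and red: "\<forall>n A. (\<forall>i. int (n0 i) \<le> n i) \<longrightarrow> ideal A R \<longrightarrow>
      (\<forall>b\<in>B. \<forall>u\<in>mpow R J (n - evec (fst b) 1). x b \<otimes>\<^bsub>R\<^esub> u \<in> A) \<longrightarrow> mpow R J n \<subseteq> A"
    using exists_joint_reduction[of d J, OF assms(5,2,3) J B, of fst] by (elim exE conjE)
  define y where "y i j = x (i, j)" for i j
  have y: "y i j \<in> J i" if "j \<in> {1..r i}" for i j
    using x that by (auto simp add: y_def B_def)
  have yc: "y i j \<in> carrier R" if "j \<in> {1..r i}" for i j
    using ideal.Icarr[OF Jid y[OF that]] .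
  \<comment> \<open>\<open>D\<close> collects the degrees \<open>m\<close> occurring in the
    generators. The shift in \<open>N\<close> ensures that \<open>n - m\<close> is still above
    \<open>n0\<close> for every \<open>m\<close> in \<open>D\<close>.\<close>
  define D where "D = (\<Union>g\<in>G. {m. g m \<noteq> \<zero>\<^bsub>R\<^esub>})"
  have D: "finite D" using G(1,2) by (auto simp: D_def rees_sum_def laurent_ring_sel)
  define N where "N i = n0 i + (\<Sum>m\<in>D. nat \<bar>m i\<bar>)" for i
  have eq: "?F n = (\<Oplus>\<^bsub>ideals_set R\<^esub> i \<in> UNIV. \<Oplus>\<^bsub>ideals_set R\<^esub> j \<in> {1..r i}.
         y i j <#\<^bsub>R\<^esub> ?F (n - evec i 1))" (is "_ = ?A") if n: "\<forall>i. int (N i) \<le> n i" for n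
  proof
    have in_id: "ideal (y i j <#\<^bsub>R\<^esub> ?F (n - evec i 1)) R" if "j \<in> {1..r i}" for i j
      using ideal_l_coset[OF Fid yc[OF that]] .
    have in_sum: "ideal (\<Oplus>\<^bsub>ideals_set R\<^esub> j \<in> {1..r i}. y i j <#\<^bsub>R\<^esub> ?F (n - evec i 1)) R" for i
      by (rule ideals_finsum_ideal) (use in_id in auto)
    have A: "ideal ?A R" by (rule ideals_finsum_ideal) (use in_sum in auto)
    have mem: "y i j \<otimes>\<^bsub>R\<^esub> u \<in> ?A" if "j \<in> {1..r i}" "u \<in> ?F (n - evec i 1)" for i j u
    proof -
      have "y i j \<otimes>\<^bsub>R\<^esub> u \<in> y i j <#\<^bsub>R\<^esub> ?F (n - evec i 1)" using that(2) by (auto simp: l_coset_def)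
      also have "\<dots> \<subseteq> (\<Oplus>\<^bsub>ideals_set R\<^esub> j \<in> {1..r i}. y i j <#\<^bsub>R\<^esub> ?F (n - evec i 1))"
        by (rule ideals_finsum_upper) (use in_id that(1) in auto)
      also have "\<dots> \<subseteq> ?A"
        by (rule ideals_finsum_upper[where i = i]) (use in_sum in auto)
      finally show ?thesis .
    qed
    show "?A \<subseteq> ?F n"
    proof (rule ideals_finsum_least[OF _ _ Fid])
      fix i
      show "(\<Oplus>\<^bsub>ideals_set R\<^esub> j \<in> {1..r i}. y i j <#\<^bsub>R\<^esub> ?F (n - evec i 1)) \<subseteq> ?F n"
      proof (rule ideals_finsum_least[OF _ _ Fid])
        fix j assume j: "j \<in> {1..r i}"
        have "y i j \<in> ?F (evec i 1)" using y[OF j] JI F_evec by blast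
        then have "y i j \<otimes>\<^bsub>R\<^esub> u \<in> ?F n" if "u \<in> ?F (n - evec i 1)" for u
          using FF[of "y i j" "evec i 1" u "n - evec i 1"] that by simp
        then show "y i j <#\<^bsub>R\<^esub> ?F (n - evec i 1) \<subseteq> ?F n" by (auto simp: l_coset_def)
      qed (use in_id in auto)
    qed (use in_sum in auto)
    show "?F n \<subseteq> ?A"
    proof
      fix a assume a: "a \<in> ?F n"
      \<comment> \<open>Expand the monomial with coefficient \<open>a\<close> in the generators
        \<open>G\<close> and compare coefficients in degree \<open>n\<close>: \<open>a\<close>
        becomes a sum of terms \<open>c g k\<close> times \<open>g (n - k)\<close>, with
        \<open>c g k\<close> in \<open>J(k)\<close>.\<close>
      have "lmonom R a n \<in> rees_sum R ?F"
        using a lmonom_carrier[OF ideal.Icarr[OF Fid a]] ideal_zero[OF Fid]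
        by (auto simp: rees_sum_def lmonom_def)
      then obtain c where c: "c \<in> G \<rightarrow> ext_rees R J"
        and lm: "lmonom R a n = (\<Oplus>\<^bsub>?L\<^esub> g \<in> G. c g \<otimes>\<^bsub>?L\<^esub> g)"
        unfolding G(3) by blast
      have cg: "c g \<in> carrier ?L" "c g k \<in> mpow R J k" if "g \<in> G" for g k
        using ext_rees_coeff[of J, OF Jid Jmult] c that by blast+
      have gL: "g \<in> carrier ?L" "g m \<in> ?F m" if "g \<in> G" for g m
        using G(2) that by (auto simp: rees_sum_def)
      have "a = (\<Oplus>\<^bsub>?L\<^esub> g \<in> G. c g \<otimes>\<^bsub>?L\<^esub> g) n"
        by (simp flip: lm add: lmonom_def)
      also have "\<dots> = (\<Oplus>\<^bsub>R\<^esub> g\<in>G. (c g \<otimes>\<^bsub>?L\<^esub> g) n)"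
        by (rule laurent_finsum_apply[OF G(1)]) (use laurent_mult_closed cg(1) gL(1) in blast)
      also have "\<dots> \<in> ?A"
      proof (rule finsum_ideal_mem[OF A], rule laurent_mult_apply_mem[OF A])
        fix g k assume g: "g \<in> G"
        let ?m = "n - k"
        have gc: "g ?m \<in> carrier R" using ideal.Icarr[OF Fid gL(2)[OF g]] .
        show "c g k \<otimes>\<^bsub>R\<^esub> g ?m \<in> ?A"
        proof (cases "g ?m = \<zero>\<^bsub>R\<^esub>")
          case True
          then show ?thesis
            using ideal_zero[OF A] ideal.Icarr[OF mpow_ideal[of J, OF Jid] cg(2)[OF g]] by simp
        next
          case False
          then have mD: "?m \<in> D" using g by (auto simp: D_def)
          have k: "int (n0 i) \<le> k i" for i
          proof -
            have "nat \<bar>?m i\<bar> \<le> (\<Sum>m\<in>D. nat \<bar>m i\<bar>)"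
              using member_le_sum[OF mD, of "\<lambda>m. nat \<bar>m i\<bar>"] D by simp
            then have "int (n0 i) + \<bar>?m i\<bar> \<le> n i" using n[rule_format, of i] unfolding N_def by linarith
            then show ?thesis by simp
          qed
          \<comment> \<open>The reduction of \<open>J(k)\<close> is tested against the colon ideal
            of \<open>?A\<close> by \<open>g ?m\<close>. For \<open>u\<close> in
            \<open>J(k - e_i)\<close>, the product of \<open>u\<close> and \<open>g ?m\<close> lies
            in \<open>F(n - e_i)\<close>, which \<open>y i j\<close> multiplies into
            \<open>?A\<close>.\<close>
          have "mpow R J k \<subseteq> {s \<in> carrier R. s \<otimes>\<^bsub>R\<^esub> g ?m \<in> ?A}"
          proof (rule red[rule_format, OF k ideal_colon[OF A gc]])
            fix b u assume b: "b \<in> B" and u: "u \<in> mpow R J (k - evec (fst b) 1)"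
            obtain i j where ij: "b = (i, j)" "j \<in> {1..r i}" using b by (auto simp: B_def)
            have uc: "u \<in> carrier R" using ideal.Icarr[OF mpow_ideal[of J, OF Jid] u] .
            have "u \<in> ?F (k - evec i 1)" using u JF ij(1) by auto
            then have "u \<otimes>\<^bsub>R\<^esub> g ?m \<in> ?F (k - evec i 1 + ?m)" using FF gL(2)[OF g] by blast
            moreover have "k - evec i 1 + ?m = n - evec i 1" by simp
            ultimately have "y i j \<otimes>\<^bsub>R\<^esub> (u \<otimes>\<^bsub>R\<^esub> g ?m) \<in> ?A" using mem[OF ij(2)] by simp
            then show "x b \<otimes>\<^bsub>R\<^esub> u \<in> {s \<in> carrier R. s \<otimes>\<^bsub>R\<^esub> g ?m \<in> ?A}"
              using yc[OF ij(2)] uc gc ij(1) by (simp add: y_def m_assoc)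
          qed
          then show ?thesis using cg(2)[OF g] by blast
        qed
      qed
      finally show "a \<in> ?A" .
    qed
  qed
  have large: "for_large (\<lambda>n. ?F n = (\<Oplus>\<^bsub>ideals_set R\<^esub> i \<in> UNIV. \<Oplus>\<^bsub>ideals_set R\<^esub> j \<in> {1..r i}.
         y i j <#\<^bsub>R\<^esub> ?F (n - evec i 1)))"
    unfolding for_large_def using eq by blast
  have "degree_one_strong_homogeneous_joint_reduction R I r y"
    unfolding degree_one_strong_homogeneous_joint_reduction_def strong_homogeneous_joint_reduction_def
    using large subsetD[OF JI y] by simp
  then show ?thesis using large y JI by (intro exI[of _ y]) auto
qed

end
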